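(* Let $F=\alpha+\beta$ be a Randers metric on a smooth manifold $M$, defined by a Riemannian metric $g$ and a vector field $X$, i.e. $\alpha(x,y)=\sqrt{g(y,y)}$ and $\beta(y)=g(X,y)$. Let $\tilde F=e^fF$ be conformally related to $F$, where $f:M\to\mathbb{R}$ is smooth. Then $\tilde F$ is of Douglas type if and only if $$d\beta(Y,Z)+(Yf)\,g(X,Z)-(Zf)\,g(X,Y)=0\qquad\text{for all vector fields } Y,Z \text{ on } M.$$
   Context: A Randers metric is a Finsler metric $F=\alpha+\beta$ with $\alpha(x,y)=\sqrt{g_x(y,y)}$ for a Riemannian metric $g$ and $\beta$ a 1-form with $\|\beta\|_\alpha<1$. The convention for the exterior derivative is $d\beta(Y,Z)=Y(\beta(Z))-Z(\beta(Y))-\beta([Y,Z])$. A Finsler metric with spray coefficients $G^i$ is of Douglas type if its Douglas tensor $D^{\,i}_{jkl}=\frac{\partial^3}{\partial y^j\partial y^k\partial y^l}\left(G^i-\frac{1}{n+1}\frac{\partial G^m}{\partial y^m}y^i\right)$, $n=\dim M$, vanishes; it is a known fact that a Randers metric $\alpha+\beta$ is of Douglas type if and only if $\beta$ is closed. *)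

theory Defs
  imports "HOL-Analysis.Analysis"
begin

section \<open>Smooth maps between Euclidean spaces\<close>

fun Ck_on :: "nat \<Rightarrow> 'a::euclidean_space set \<Rightarrow> ('a \<Rightarrow> 'b::euclidean_space) \<Rightarrow> bool" where
  "Ck_on 0 S f \<longleftrightarrow> continuous_on S f"
| "Ck_on (Suc k) S f \<longleftrightarrow>
     (\<forall>x\<in>S. f differentiable (at x)) \<and> (\<forall>v. Ck_on k S (\<lambda>x. frechet_derivative f (at x) v))"

text \<open>Only used for open \<open>S\<close>, so derivatives at \<open>x \<in> S\<close> depend on the values of \<open>f\<close> on \<open>S\<close> only.\<close>

definition smooth_on :: "'a::euclidean_space set \<Rightarrow> ('a \<Rightarrow> 'b::euclidean_space) \<Rightarrow> bool" where
  "smooth_on S f \<longleftrightarrow> (\<forall>k. Ck_on k S f)"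


section \<open>Smooth manifolds\<close>

text \<open>The manifold is the whole type \<open>'m\<close>; a chart is a pair of its domain and its coordinate
  map. The atlas need not be maximal.\<close>

type_synonym ('m, 'n) chart = "'m set \<times> ('m \<Rightarrow> real ^ 'n)"

type_synonym ('m, 'n) atlas = "('m, 'n) chart set"

definition chart_image :: "('m, 'n::finite) chart \<Rightarrow> (real ^ 'n) set" where
  "chart_image c = snd c ` fst c"

definition chart_inv :: "('m, 'n::finite) chart \<Rightarrow> real ^ 'n \<Rightarrow> 'm" where
  "chart_inv c = inv_into (fst c) (snd c)"

definition smooth_manifold ::
  "('m::{t2_space, second_countable_topology}, 'n::finite) atlas \<Rightarrow> bool" where
  "smooth_manifold A \<longleftrightarrow>
     (\<Union>c\<in>A. fst c) = UNIV \<and>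
     (\<forall>c\<in>A. open (fst c) \<and> open (chart_image c) \<and>
        homeomorphism (fst c) (chart_image c) (snd c) (chart_inv c)) \<and>
     (\<forall>c\<in>A. \<forall>c'\<in>A. smooth_on (snd c ` (fst c \<inter> fst c')) (snd c' \<circ> chart_inv c))"

definition charts_at :: "('m, 'n::finite) atlas \<Rightarrow> 'm \<Rightarrow> ('m, 'n) chart set" where
  "charts_at A p = {c \<in> A. p \<in> fst c}"

definition smooth_function :: "('m, 'n::finite) atlas \<Rightarrow> ('m \<Rightarrow> real) \<Rightarrow> bool" where
  "smooth_function A f \<longleftrightarrow> (\<forall>c\<in>A. smooth_on (chart_image c) (f \<circ> chart_inv c))"


section \<open>Tangent vectors and vector fields\<close>

text \<open>A tangent vector at \<open>p\<close> is the family of its components in all charts around \<open>p\<close>, related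
  by the Jacobians of the coordinate changes, and set to \<open>0\<close> at all other arguments.
  The vector space operations are pointwise.\<close>

type_synonym ('m, 'n) tvec = "('m, 'n) chart \<Rightarrow> real ^ 'n"

definition coord_change ::
  "('m, 'n::finite) chart \<Rightarrow> ('m, 'n) chart \<Rightarrow> 'm \<Rightarrow> real ^ 'n \<Rightarrow> real ^ 'n" where
  "coord_change c c' p = frechet_derivative (snd c' \<circ> chart_inv c) (at (snd c p))"

definition tangent_space :: "('m, 'n::finite) atlas \<Rightarrow> 'm \<Rightarrow> ('m, 'n) tvec set" where
  "tangent_space A p =
     {v. (\<forall>c\<in>charts_at A p. \<forall>c'\<in>charts_at A p. v c' = coord_change c c' p (v c)) \<and>
         (\<forall>c. c \<notin> charts_at A p \<longrightarrow> v c = 0)}"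

text \<open>The tangent vector \<open>\<Sum>\<^sub>i y\<^sup>i \<partial>/\<partial>x\<^sup>i\<close> at \<open>p\<close> in the coordinates of the chart \<open>c\<close>.\<close>

definition coord_vec ::
  "('m, 'n::finite) atlas \<Rightarrow> ('m, 'n) chart \<Rightarrow> 'm \<Rightarrow> real ^ 'n \<Rightarrow> ('m, 'n) tvec" where
  "coord_vec A c p y = (\<lambda>c'. if c' \<in> charts_at A p then coord_change c c' p y else 0)"

definition vector_field :: "('m, 'n::finite) atlas \<Rightarrow> ('m \<Rightarrow> ('m, 'n) tvec) \<Rightarrow> bool" where
  "vector_field A Y \<longleftrightarrow>
     (\<forall>p. Y p \<in> tangent_space A p) \<and>
     (\<forall>c\<in>A. smooth_on (chart_image c) (\<lambda>x. Y (chart_inv c x) c))"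

text \<open>The derivative \<open>Yh\<close>; it is computed in an arbitrary chart around \<open>p\<close>, whose choice is
  immaterial for smooth \<open>h\<close>.\<close>

definition vf_apply ::
  "('m, 'n::finite) atlas \<Rightarrow> ('m \<Rightarrow> ('m, 'n) tvec) \<Rightarrow> ('m \<Rightarrow> real) \<Rightarrow> 'm \<Rightarrow> real" where
  "vf_apply A Y h p =
     (let c = (SOME c. c \<in> charts_at A p)
      in frechet_derivative (h \<circ> chart_inv c) (at (snd c p)) (Y p c))"

text \<open>In each chart, \<open>[Y,Z]\<^sup>i = \<Sum>\<^sub>j (Y\<^sup>j \<partial>Z\<^sup>i/\<partial>x\<^sup>j - Z\<^sup>j \<partial>Y\<^sup>i/\<partial>x\<^sup>j)\<close>.\<close>

definition lie_bracket ::
  "('m, 'n::finite) atlas \<Rightarrow> ('m \<Rightarrow> ('m, 'n) tvec) \<Rightarrow> ('m \<Rightarrow> ('m, 'n) tvec) \<Rightarrow>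
   'm \<Rightarrow> ('m, 'n) tvec" where
  "lie_bracket A Y Z p =
     (\<lambda>c. if c \<in> charts_at A p
          then frechet_derivative (\<lambda>x. Z (chart_inv c x) c) (at (snd c p)) (Y p c)
             - frechet_derivative (\<lambda>x. Y (chart_inv c x) c) (at (snd c p)) (Z p c)
          else 0)"


section \<open>1-forms and Riemannian metrics\<close>

definition linear_on_tangent ::
  "('m, 'n::finite) atlas \<Rightarrow> 'm \<Rightarrow> (('m, 'n) tvec \<Rightarrow> real) \<Rightarrow> bool" where
  "linear_on_tangent A p l \<longleftrightarrow>
     (\<forall>u\<in>tangent_space A p. \<forall>v\<in>tangent_space A p. \<forall>a b.
        l (\<lambda>c. a *\<^sub>R u c + b *\<^sub>R v c) = a * l u + b * l v)"

definition one_form :: "('m, 'n::finite) atlas \<Rightarrow> ('m \<Rightarrow> ('m, 'n) tvec \<Rightarrow> real) \<Rightarrow> bool" where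
  "one_form A \<beta> \<longleftrightarrow>
     (\<forall>p. linear_on_tangent A p (\<beta> p)) \<and>
     (\<forall>c\<in>A. \<forall>y. smooth_on (chart_image c)
        (\<lambda>x. \<beta> (chart_inv c x) (coord_vec A c (chart_inv c x) y)))"

definition ext_deriv ::
  "('m, 'n::finite) atlas \<Rightarrow> ('m \<Rightarrow> ('m, 'n) tvec \<Rightarrow> real) \<Rightarrow>
   ('m \<Rightarrow> ('m, 'n) tvec) \<Rightarrow> ('m \<Rightarrow> ('m, 'n) tvec) \<Rightarrow> 'm \<Rightarrow> real" where
  "ext_deriv A \<beta> Y Z p =
     vf_apply A Y (\<lambda>q. \<beta> q (Z q)) p - vf_apply A Z (\<lambda>q. \<beta> q (Y q)) p
       - \<beta> p (lie_bracket A Y Z p)"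

definition riemannian_metric ::
  "('m, 'n::finite) atlas \<Rightarrow> ('m \<Rightarrow> ('m, 'n) tvec \<Rightarrow> ('m, 'n) tvec \<Rightarrow> real) \<Rightarrow> bool" where
  "riemannian_metric A g \<longleftrightarrow>
     (\<forall>p. (\<forall>u\<in>tangent_space A p. linear_on_tangent A p (g p u)) \<and>
          (\<forall>u\<in>tangent_space A p. \<forall>v\<in>tangent_space A p. g p u v = g p v u) \<and>
          (\<forall>v\<in>tangent_space A p. v \<noteq> (\<lambda>_. 0) \<longrightarrow> g p v v > 0)) \<and>
     (\<forall>c\<in>A. \<forall>y z. smooth_on (chart_image c)
        (\<lambda>x. g (chart_inv c x) (coord_vec A c (chart_inv c x) y)
                               (coord_vec A c (chart_inv c x) z)))"

definition flat ::
  "('m \<Rightarrow> ('m, 'n::finite) tvec \<Rightarrow> ('m, 'n) tvec \<Rightarrow> real) \<Rightarrow> ('m \<Rightarrow> ('m, 'n) tvec) \<Rightarrow>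
   'm \<Rightarrow> ('m, 'n) tvec \<Rightarrow> real" where
  "flat g X p v = g p (X p) v"

text \<open>\<open>\<parallel>\<beta>\<parallel>\<^sub>\<alpha>\<close> at the point \<open>p\<close>. The set is nonempty, since the dimension \<open>CARD('n)\<close> is positive,
  and bounded when \<open>g\<close> is a Riemannian metric and \<open>\<beta>\<close> a 1-form.\<close>

definition conorm ::
  "('m, 'n::finite) atlas \<Rightarrow> ('m \<Rightarrow> ('m, 'n) tvec \<Rightarrow> ('m, 'n) tvec \<Rightarrow> real) \<Rightarrow>
   ('m \<Rightarrow> ('m, 'n) tvec \<Rightarrow> real) \<Rightarrow> 'm \<Rightarrow> real" where
  "conorm A g \<beta> p =
     Sup {\<beta> p v / sqrt (g p v v) | v. v \<in> tangent_space A p \<and> v \<noteq> (\<lambda>_. 0)}"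


section \<open>Finsler metrics\<close>

text \<open>Functions on the tangent bundle have type \<open>'m \<Rightarrow> ('m, 'n) tvec \<Rightarrow> real\<close>. In the induced
  coordinates \<open>(x, y)\<close> they become functions on an open subset of \<open>\<real>\<^sup>n \<times> \<real>\<^sup>n\<close>.\<close>

definition in_chart ::
  "('m, 'n::finite) atlas \<Rightarrow> ('m, 'n) chart \<Rightarrow> ('m \<Rightarrow> ('m, 'n) tvec \<Rightarrow> real) \<Rightarrow>
   (real ^ 'n) \<times> (real ^ 'n) \<Rightarrow> real" where
  "in_chart A c F = (\<lambda>(x, y). F (chart_inv c x) (coord_vec A c (chart_inv c x) y))"

definition slit_domain :: "('m, 'n::finite) chart \<Rightarrow> ((real ^ 'n) \<times> (real ^ 'n)) set" where
  "slit_domain c = chart_image c \<times> (- {0})"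

definition partial_x ::
  "'n \<Rightarrow> ((real ^ 'n) \<times> (real ^ 'n) \<Rightarrow> real) \<Rightarrow> (real ^ 'n) \<times> (real ^ 'n) \<Rightarrow> real" where
  "partial_x i H z = frechet_derivative H (at z) (axis i 1, 0)"

definition partial_y ::
  "'n \<Rightarrow> ((real ^ 'n) \<times> (real ^ 'n) \<Rightarrow> real) \<Rightarrow> (real ^ 'n) \<times> (real ^ 'n) \<Rightarrow> real" where
  "partial_y i H z = frechet_derivative H (at z) (0, axis i 1)"

definition fundamental_tensor ::
  "((real ^ 'n) \<times> (real ^ 'n) \<Rightarrow> real) \<Rightarrow> (real ^ 'n) \<times> (real ^ 'n) \<Rightarrow> real ^ 'n ^ 'n" where
  "fundamental_tensor H z = (\<chi> i j. 1 / 2 * partial_y i (partial_y j (\<lambda>w. (H w)\<^sup>2)) z)"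

definition finsler_metric ::
  "('m, 'n::finite) atlas \<Rightarrow> ('m \<Rightarrow> ('m, 'n) tvec \<Rightarrow> real) \<Rightarrow> bool" where
  "finsler_metric A F \<longleftrightarrow>
     (\<forall>p. \<forall>v\<in>tangent_space A p. v \<noteq> (\<lambda>_. 0) \<longrightarrow> F p v > 0) \<and>
     (\<forall>p. \<forall>v\<in>tangent_space A p. \<forall>t\<ge>0. F p (\<lambda>c. t *\<^sub>R v c) = t * F p v) \<and>
     (\<forall>c\<in>A. smooth_on (slit_domain c) (in_chart A c F)) \<and>
     (\<forall>c\<in>A. \<forall>z\<in>slit_domain c. \<forall>u. u \<noteq> 0 \<longrightarrow>
        u \<bullet> (fundamental_tensor (in_chart A c F) z *v u) > 0)"

definition randers_metric ::
  "('m, 'n::finite) atlas \<Rightarrow> ('m \<Rightarrow> ('m, 'n) tvec \<Rightarrow> ('m, 'n) tvec \<Rightarrow> real) \<Rightarrow>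
   ('m \<Rightarrow> ('m, 'n) tvec \<Rightarrow> real) \<Rightarrow> ('m \<Rightarrow> ('m, 'n) tvec \<Rightarrow> real) \<Rightarrow> bool" where
  "randers_metric A g \<beta> F \<longleftrightarrow>
     finsler_metric A F \<and> riemannian_metric A g \<and> one_form A \<beta> \<and>
     (\<forall>p. conorm A g \<beta> p < 1) \<and>
     (\<forall>p. \<forall>v\<in>tangent_space A p. F p v = sqrt (g p v v) + \<beta> p v)"


section \<open>Spray coefficients and the Douglas tensor\<close>

text \<open>\<open>G\<^sup>i = 1/4 g\<^sup>i\<^sup>l ([F\<^sup>2]\<^bsub>x\<^sup>k y\<^sup>l\<^esub> y\<^sup>k - [F\<^sup>2]\<^bsub>x\<^sup>l\<^esub>)\<close>, for a Finsler metric given in coordinates by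
  \<open>H\<close>; geodesics satisfy \<open>x'' + 2 G(x, x') = 0\<close>.\<close>

definition spray_coeff ::
  "((real ^ 'n) \<times> (real ^ 'n) \<Rightarrow> real) \<Rightarrow> 'n \<Rightarrow> (real ^ 'n) \<times> (real ^ 'n) \<Rightarrow> real" where
  "spray_coeff H i z =
     1 / 4 * (\<Sum>l\<in>UNIV. matrix_inv (fundamental_tensor H z) $ i $ l *
       ((\<Sum>k\<in>UNIV. partial_x k (partial_y l (\<lambda>w. (H w)\<^sup>2)) z * snd z $ k)
         - partial_x l (\<lambda>w. (H w)\<^sup>2) z))"

definition douglas_tensor ::
  "((real ^ 'n) \<times> (real ^ 'n) \<Rightarrow> real) \<Rightarrow> 'n \<Rightarrow> 'n \<Rightarrow> 'n \<Rightarrow> 'n \<Rightarrow>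
   (real ^ 'n) \<times> (real ^ 'n) \<Rightarrow> real" where
  "douglas_tensor H i j k l =
     partial_y j (partial_y k (partial_y l
       (\<lambda>w. spray_coeff H i w
          - 1 / (real CARD('n) + 1) *
            (\<Sum>m\<in>UNIV. partial_y m (spray_coeff H m) w) * snd w $ i)))"

definition douglas_type ::
  "('m, 'n::finite) atlas \<Rightarrow> ('m \<Rightarrow> ('m, 'n) tvec \<Rightarrow> real) \<Rightarrow> bool" where
  "douglas_type A F \<longleftrightarrow>
     finsler_metric A F \<and>
     (\<forall>c\<in>A. \<forall>z\<in>slit_domain c. \<forall>i j k l. douglas_tensor (in_chart A c F) i j k l z = 0)"

end

theory Submission
  imports Defs
begin

text \<open>
  The conformal factor is absorbed into the data: \<open>e\<^sup>f F\<close> is the Randers metric with Riemannian part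
  \<open>e\<^sup>2\<^sup>f g\<close> and 1-form \<open>e\<^sup>f \<beta>\<close>, and
  \<open>d(e\<^sup>f \<beta>)(Y, Z) = e\<^sup>f (d\<beta>(Y, Z) + (Yf) \<beta>(Z) - (Zf) \<beta>(Y))\<close>.
  So the condition of the theorem says that \<open>e\<^sup>f \<beta>\<close> is closed, and the theorem follows from the
  statement that a Randers metric is of Douglas type if and only if its 1-form is closed.

  The latter is a computation in one chart (\<open>douglas_iff_closed\<close>). Let \<open>\<alpha>\<^sup>2 = \<gamma>\<^sub>i\<^sub>j y\<^sup>i y\<^sup>j\<close>, \<open>\<beta> = b\<^sub>i y\<^sup>i\<close> and
  \<open>W\<^sub>k\<^sub>l = \<partial>\<^sub>k b\<^sub>l - \<partial>\<^sub>l b\<^sub>k\<close>. Solving the linear system that defines the spray gives (\<open>spray_coeff_H\<close>)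
  \<open>G\<^sup>i = \<Gamma>\<^sup>i + P y\<^sup>i + (\<alpha>/2) w\<^sup>i\<close> with \<open>w\<^sup>i = \<gamma>\<^sup>i\<^sup>l W\<^sub>k\<^sub>l y\<^sup>k\<close>,
  where \<open>\<Gamma>\<close> is the spray of \<open>\<gamma>\<close>, quadratic in \<open>y\<close>, and \<open>P\<close> is some function positively homogeneous
  of degree 1 in \<open>y\<close>. The correction by the divergence in the Douglas tensor removes \<open>P y\<close> by Euler's
  theorem, and changes \<open>\<Gamma>\<close> by a quadratic term only; the divergence of \<open>\<alpha> w\<close> is zero since \<open>W\<close> is
  skew. After three derivatives in \<open>y\<close> only those of \<open>\<alpha> w / 2\<close> are left (\<open>douglas_tensor_H\<close>). They
  vanish if \<open>W = 0\<close>. Conversely, contracting three times with a vector \<open>v\<close> at a point \<open>y\<close> which is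
  \<open>\<gamma>\<close>-orthogonal to \<open>v\<close> leaves a positive multiple of \<open>w(v)\<close>, hence \<open>w\<close> and \<open>W\<close> vanish. Such a \<open>y \<noteq> 0\<close>
  exists in dimension at least 2; in dimension 1 there is nothing to prove, because \<open>W\<close> is skew.

  It remains to compare the coordinate condition with the one on vector fields (\<open>conformal_curl\<close>).
  The evaluation of \<open>d\<beta>(Y, Z)\<close> in a chart needs that the Lie bracket is a tangent vector, which rests on the
  symmetry of second derivatives (\<open>lie_bracket_tangent\<close>). To recover the coordinate condition, one needs
  global vector fields with a prescribed value at a point, which are obtained by a bump function
  (\<open>vector_field_exists\<close>).
\<close>

section \<open>Calculus of differentiable maps of class C^k\<close>

lemma Ck_on_Suc_has_derivative:
  "Ck_on (Suc k) S f \<Longrightarrow> x \<in> S \<Longrightarrow> (f has_derivative frechet_derivative f (at x)) (at x)"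
  by (auto simp: frechet_derivative_works[symmetric])

text \<open>\<open>Ck_on\<close> refers to the derivatives at all points of an open set, which are determined by the values of
the function there. This allows a map to be replaced by a formula that is valid on \<open>S\<close> only, as happens
for every expression in a chart.\<close>

lemma Ck_on_cong:
  assumes "open S" "Ck_on k S f" "\<And>x. x \<in> S \<Longrightarrow> f x = g x"
  shows "Ck_on k S g"
  using assms(2,3)
proof (induction k arbitrary: f g)
  case 0
  then show ?case by (auto cong: continuous_on_cong)
next
  case (Suc k)
  have d: "(g has_derivative frechet_derivative f (at x)) (at x)" if "x \<in> S" for x
    using has_derivative_transform_within_open[OF Ck_on_Suc_has_derivative[OF Suc.prems(1) that] assms(1) that]
      Suc.prems(2) by blast
  have eq: "frechet_derivative f (at x) = frechet_derivative g (at x)" if "x \<in> S" for x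
    using frechet_derivative_at[OF d[OF that]] .
  have "Ck_on k S (\<lambda>x. frechet_derivative g (at x) v)" for v
    by (rule Suc.IH[of "\<lambda>x. frechet_derivative f (at x) v"]) (use Suc.prems eq in auto)
  then show ?case using d by (auto simp: differentiable_def)
qed

lemma Ck_on_SucI:
  assumes S: "open S" and d: "\<And>x. x \<in> S \<Longrightarrow> (f has_derivative f' x) (at x)"
    and "\<And>v. Ck_on k S (\<lambda>x. f' x v)"
  shows "Ck_on (Suc k) S f"
proof -
  have "f' x = frechet_derivative f (at x)" if "x \<in> S" for x
    using frechet_derivative_at[OF d[OF that]] .
  then have "Ck_on k S (\<lambda>x. frechet_derivative f (at x) v)" for v
    using Ck_on_cong[OF S assms(3)[of v]] by auto
  then show ?thesis using d by (auto simp: differentiable_def)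
qed

lemma Ck_on_Un:
  "open S \<Longrightarrow> open T \<Longrightarrow> Ck_on k S f \<Longrightarrow> Ck_on k T f \<Longrightarrow> Ck_on k (S \<union> T) f"
  by (induction k arbitrary: f) (auto intro: continuous_on_open_Un)

lemma Ck_on_SucD: "Ck_on (Suc k) S f \<Longrightarrow> Ck_on k S f"
proof (induction k arbitrary: f)
  case 0
  then show ?case
    by (auto intro!: differentiable_imp_continuous_on differentiable_at_imp_differentiable_on)
next
  case (Suc k)
  have "Ck_on k S (\<lambda>x. frechet_derivative f (at x) v)" for v
    by (rule Suc.IH) (use Suc.prems in auto)
  then show ?case using Suc.prems by auto
qed

lemma Ck_on_const: "Ck_on k S (\<lambda>x. c)"
proof (induction k arbitrary: c)
  case (Suc k)
  then show ?case by simp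
qed simp

lemma Ck_on_bounded_linear:
  assumes "bounded_linear L" "open S"
  shows "Ck_on k S L"
proof (cases k)
  case 0
  then show ?thesis using linear_continuous_on[OF assms(1)] by simp
next
  case (Suc j)
  show ?thesis unfolding Suc
    by (rule Ck_on_SucI[OF assms(2) bounded_linear_imp_has_derivative[OF assms(1)] Ck_on_const])
qed

lemma Ck_on_add:
  assumes "open S" "Ck_on k S f" "Ck_on k S g"
  shows "Ck_on k S (\<lambda>x. f x + g x)"
  using assms(2,3)
proof (induction k arbitrary: f g)
  case 0
  then show ?case by (auto intro: continuous_on_add)
next
  case (Suc k)
  show ?case
    by (rule Ck_on_SucI[OF assms(1) has_derivative_add[OF Ck_on_Suc_has_derivative Ck_on_Suc_has_derivative]])
      (use Suc in auto)
qed

lemma Ck_on_sum: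
  assumes "open S" "\<And>i. i \<in> I \<Longrightarrow> Ck_on k S (f i)"
  shows "Ck_on k S (\<lambda>x. \<Sum>i\<in>I. f i x)"
  using assms(2)
  by (induction I rule: infinite_finite_induct) (auto intro: Ck_on_const Ck_on_add[OF assms(1)])

lemma Ck_on_bilinear:
  assumes B: "bounded_bilinear B" and S: "open S" and "Ck_on k S f" "Ck_on k S g"
  shows "Ck_on k S (\<lambda>x. B (f x) (g x))"
  using assms(3,4)
proof (induction k arbitrary: f g)
  case 0
  then show ?case using bounded_bilinear.continuous_on[OF B] by auto
next
  case (Suc k)
  show ?case
  proof (rule Ck_on_SucI[OF S bounded_bilinear.FDERIV[OF B Ck_on_Suc_has_derivative[OF Suc.prems(1)]
          Ck_on_Suc_has_derivative[OF Suc.prems(2)]]])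
    fix v
    have "Ck_on k S (\<lambda>x. frechet_derivative f (at x) v)" "Ck_on k S (\<lambda>x. frechet_derivative g (at x) v)"
      using Suc.prems by auto
    then show "Ck_on k S (\<lambda>x. B (f x) (frechet_derivative g (at x) v) + B (frechet_derivative f (at x) v) (g x))"
      by (intro Ck_on_add S Suc.IH Suc.prems[THEN Ck_on_SucD])
  qed
qed

lemmas Ck_on_scaleR = Ck_on_bilinear[OF bounded_bilinear_scaleR]
lemmas Ck_on_mult = Ck_on_bilinear[OF bounded_bilinear_mult]
lemmas Ck_on_inner = Ck_on_bilinear[OF bounded_bilinear_inner]

text \<open>Derivatives in a direction that varies with the base point are reduced by this to derivatives in
fixed directions, the only ones that occur in \<open>Ck_on\<close>.\<close>

lemma frechet_derivative_expand:
  fixes \<phi> :: "'a::euclidean_space \<Rightarrow> 'b::euclidean_space"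
  assumes "\<phi> differentiable (at y)"
  shows "frechet_derivative \<phi> (at y) v = (\<Sum>b\<in>Basis. (v \<bullet> b) *\<^sub>R frechet_derivative \<phi> (at y) b)"
proof -
  have "linear (frechet_derivative \<phi> (at y))" using assms by (rule linear_frechet_derivative)
  then have "frechet_derivative \<phi> (at y) (\<Sum>b\<in>Basis. (v \<bullet> b) *\<^sub>R b) = (\<Sum>b\<in>Basis. (v \<bullet> b) *\<^sub>R frechet_derivative \<phi> (at y) b)"
    by (simp add: linear_sum linear_scale)
  then show ?thesis by (simp only: euclidean_representation)
qed

text \<open>By the chain rule \<open>D(f \<circ> g)(x) v\<close> is the sum over the basis of \<open>(Dg(x) v \<bullet> b) Df(g x) b\<close>. All factors
are one order less differentiable, and the composites \<open>Df(g x) b\<close> are covered by the induction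
hypothesis.\<close>

lemma Ck_on_compose:
  fixes f :: "'b::euclidean_space \<Rightarrow> 'c::euclidean_space" and g :: "'a::euclidean_space \<Rightarrow> 'b"
  assumes S: "open S" and "Ck_on k T f" "Ck_on k S g" "\<And>x. x \<in> S \<Longrightarrow> g x \<in> T"
  shows "Ck_on k S (\<lambda>x. f (g x))"
  using assms(2,3)
proof (induction k arbitrary: f)
  case 0
  then show ?case using continuous_on_compose2[of T f S g] assms(4) by auto
next
  case (Suc k)
  let ?f = "\<lambda>x. frechet_derivative f (at x)" and ?g = "\<lambda>x. frechet_derivative g (at x)"
  have eq: "?f (g x) v = (\<Sum>b\<in>Basis. (v \<bullet> b) *\<^sub>R ?f (g x) b)" if "x \<in> S" for x v
    by (rule frechet_derivative_expand) (use Suc.prems(1) assms(4)[OF that] in auto)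
  have d: "((\<lambda>x. f (g x)) has_derivative (\<lambda>v. \<Sum>b\<in>Basis. (?g x v \<bullet> b) *\<^sub>R ?f (g x) b)) (at x)"
    if "x \<in> S" for x
    using diff_chain_at[OF Ck_on_Suc_has_derivative[OF Suc.prems(2) that]
        Ck_on_Suc_has_derivative[OF Suc.prems(1) assms(4)[OF that]]]
    unfolding comp_def by (rule has_derivative_eq_rhs) (rule ext, rule eq[OF that])
  show ?case
  proof (rule Ck_on_SucI[OF S d])
    fix v
    have "Ck_on k S (\<lambda>x. ?f (g x) b)" for b
    proof (rule Suc.IH[OF _ Ck_on_SucD[OF Suc.prems(2)]])
      show "Ck_on k T (\<lambda>x. ?f x b)" using Suc.prems(1) by simp
    qed
    moreover have "Ck_on k S (\<lambda>x. ?g x v \<bullet> b)" for b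
      using Suc.prems(2) by (intro Ck_on_inner[OF S] Ck_on_const) simp
    ultimately show "Ck_on k S (\<lambda>x. \<Sum>b\<in>Basis. (?g x v \<bullet> b) *\<^sub>R ?f (g x) b)"
      by (intro Ck_on_sum S Ck_on_scaleR)
  qed
qed

lemma Ck_on_exp: "Ck_on k UNIV (exp :: real \<Rightarrow> real)"
proof (induction k)
  case (Suc k)
  have "(exp has_derivative (\<lambda>v. exp x * v)) (at x)" for x :: real
    using DERIV_exp[of x] by (simp add: has_field_derivative_def)
  then show ?case
    by (rule Ck_on_SucI[OF open_UNIV]) (use Suc in \<open>auto intro!: Ck_on_mult Ck_on_const\<close>)
qed (simp add: continuous_on_exp)

section \<open>Symmetry of second derivatives\<close>

text \<open>The mean value theorem, used once in the direction \<open>v\<close> and once in the direction \<open>w\<close>, turns the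
second difference over a small parallelogram into a mixed second derivative at a nearby point. The
left-hand side is symmetric in \<open>v\<close> and \<open>w\<close>, and this is what forces the symmetry of the derivatives.\<close>

lemma segment_second_difference:
  fixes f :: "'a::euclidean_space \<Rightarrow> real"
  assumes f: "\<And>y. y \<in> ball x r \<Longrightarrow> f differentiable (at y)"
    and fv: "\<And>y. y \<in> ball x r \<Longrightarrow> (\<lambda>y. frechet_derivative f (at y) v) differentiable (at y)"
    and t: "0 < t" "t * norm v + t * norm w < r"
  shows "\<exists>y. dist x y \<le> t * norm v + t * norm w \<and>
    f (x + t *\<^sub>R v + t *\<^sub>R w) - f (x + t *\<^sub>R v) - f (x + t *\<^sub>R w) + f x =
    t * t * frechet_derivative (\<lambda>y. frechet_derivative f (at y) v) (at y) w"
proof -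
  let ?D = "\<lambda>y. frechet_derivative f (at y)" and ?E = "\<lambda>y. frechet_derivative (\<lambda>y. frechet_derivative f (at y) v) (at y)"
  have near: "dist x (x + s *\<^sub>R v + u *\<^sub>R w) \<le> t * norm v + t * norm w"
    if "0 \<le> s" "s \<le> t" "0 \<le> u" "u \<le> t" for s u
  proof -
    have "dist x (x + s *\<^sub>R v + u *\<^sub>R w) = norm (s *\<^sub>R v + u *\<^sub>R w)"
      by (metis add.assoc add_diff_cancel_left' dist_commute dist_norm)
    also have "\<dots> \<le> s * norm v + u * norm w"
      using that norm_triangle_ineq[of "s *\<^sub>R v" "u *\<^sub>R w"] by simp
    also have "\<dots> \<le> t * norm v + t * norm w"
      using that by (intro add_mono mult_right_mono) auto
    finally show ?thesis .
  qed
  then have inb: "x + s *\<^sub>R v + u *\<^sub>R w \<in> ball x r" if "0 \<le> s" "s \<le> t" "0 \<le> u" "u \<le> t" for s u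
    using that t(2) by (fastforce simp: mem_ball)
  \<comment> \<open>The zero multiple of \<open>w\<close> keeps both terms in the same form, so that one rule differentiates both.\<close>
  define \<phi> where "\<phi> s = f (x + s *\<^sub>R v + t *\<^sub>R w) - f (x + s *\<^sub>R v + 0 *\<^sub>R w)" for s
  have chain: "((\<lambda>s. h (y + s *\<^sub>R u)) has_real_derivative frechet_derivative h (at (y + s *\<^sub>R u)) u) (at s)"
    if "h differentiable (at (y + s *\<^sub>R u))" for h :: "'a \<Rightarrow> real" and y u s
  proof -
    have "((\<lambda>s. y + s *\<^sub>R u) has_derivative (\<lambda>d. d *\<^sub>R u)) (at s)"
      by (auto intro!: derivative_eq_intros)
    from diff_chain_at[OF this, of h] that
    have "((\<lambda>s. h (y + s *\<^sub>R u)) has_derivative (\<lambda>d. frechet_derivative h (at (y + s *\<^sub>R u)) (d *\<^sub>R u))) (at s)"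
      unfolding frechet_derivative_works comp_def by blast
    then show ?thesis
      unfolding has_field_derivative_def
      by (rule has_derivative_eq_rhs) (simp add: linear_scale[OF linear_frechet_derivative[OF that]] fun_eq_iff)
  qed
  have "(\<phi> has_real_derivative ?D (x + s *\<^sub>R v + t *\<^sub>R w) v - ?D (x + s *\<^sub>R v + 0 *\<^sub>R w) v) (at s)"
    if "0 \<le> s" "s \<le> t" for s
  proof -
    have *: "((\<lambda>s. f (x + s *\<^sub>R v + u *\<^sub>R w)) has_real_derivative ?D (x + s *\<^sub>R v + u *\<^sub>R w) v) (at s)"
      if "0 \<le> u" "u \<le> t" for u
      using chain[of f "x + u *\<^sub>R w" s v] f[OF inb[OF \<open>0 \<le> s\<close> \<open>s \<le> t\<close> that]]
      by (simp add: add.assoc add.commute[of "u *\<^sub>R w"])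
    show ?thesis unfolding \<phi>_def
      by (rule DERIV_diff[OF * *]) (use t in auto)
  qed
  then obtain s where s: "0 < s" "s < t"
    and "\<phi> t - \<phi> 0 = (t - 0) * (?D (x + s *\<^sub>R v + t *\<^sub>R w) v - ?D (x + s *\<^sub>R v + 0 *\<^sub>R w) v)"
    using MVT2[OF t(1), of \<phi> "\<lambda>s. ?D (x + s *\<^sub>R v + t *\<^sub>R w) v - ?D (x + s *\<^sub>R v + 0 *\<^sub>R w) v"] by blast
  moreover have "((\<lambda>u. ?D (x + s *\<^sub>R v + u *\<^sub>R w) v) has_real_derivative ?E (x + s *\<^sub>R v + u *\<^sub>R w) w) (at u)"
    if "0 \<le> u" "u \<le> t" for u
    by (rule chain, rule fv, rule inb) (use s that in auto)
  then obtain u where u: "0 < u" "u < t"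
    and "?D (x + s *\<^sub>R v + t *\<^sub>R w) v - ?D (x + s *\<^sub>R v + 0 *\<^sub>R w) v = (t - 0) * ?E (x + s *\<^sub>R v + u *\<^sub>R w) w"
    using MVT2[OF t(1), of "\<lambda>u. ?D (x + s *\<^sub>R v + u *\<^sub>R w) v" "\<lambda>u. ?E (x + s *\<^sub>R v + u *\<^sub>R w) w"] by blast
  ultimately have "\<phi> t - \<phi> 0 = t * t * ?E (x + s *\<^sub>R v + u *\<^sub>R w) w" by simp
  moreover have "\<phi> t - \<phi> 0 = f (x + t *\<^sub>R v + t *\<^sub>R w) - f (x + t *\<^sub>R v) - f (x + t *\<^sub>R w) + f x"
    by (simp add: \<phi>_def)
  ultimately show ?thesis using near[of s u] s u by (intro exI[of _ "x + s *\<^sub>R v + u *\<^sub>R w"]) auto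
qed

lemma symmetric_second_derivative:
  fixes f :: "'a::euclidean_space \<Rightarrow> real"
  assumes S: "open S" "x \<in> S" and f: "Ck_on 2 S f"
  shows "frechet_derivative (\<lambda>y. frechet_derivative f (at y) v) (at x) w =
    frechet_derivative (\<lambda>y. frechet_derivative f (at y) w) (at x) v"
proof (rule ccontr)
  let ?E = "\<lambda>v y. frechet_derivative (\<lambda>y. frechet_derivative f (at y) v) (at y)"
  define e where "e = \<bar>?E v x w - ?E w x v\<bar> / 2"
  assume "?E v x w \<noteq> ?E w x v"
  then have e: "e > 0" by (simp add: e_def)
  have C: "f differentiable (at y)" "(\<lambda>y. frechet_derivative f (at y) a) differentiable (at y)"
    "continuous_on S (\<lambda>y. ?E a y b)" if "y \<in> S" for y a b
    using f that by (auto simp: numeral_2_eq_2)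
  have "isCont (\<lambda>y. ?E a y b) x" for a b
    using C(3)[OF S(2)] S continuous_on_eq_continuous_at by blast
  then have near: "\<exists>d>0. \<forall>y. dist x y < d \<longrightarrow> \<bar>?E a y b - ?E a x b\<bar> < e" for a b
    using e by (simp add: continuous_at_eps_delta dist_real_def dist_commute)
  obtain r where r: "r > 0" "ball x r \<subseteq> S" using S openE by blast
  obtain d1 d2 where d: "d1 > 0" "d2 > 0" "\<And>y. dist x y < d1 \<Longrightarrow> \<bar>?E v y w - ?E v x w\<bar> < e"
    "\<And>y. dist x y < d2 \<Longrightarrow> \<bar>?E w y v - ?E w x v\<bar> < e" using near by metis
  define m where "m = min r (min d1 d2)"
  define t where "t = m / (norm v + norm w + 1)"
  have m: "m > 0" using r d by (simp add: m_def)
  have p: "norm v + norm w + 1 > 0" using norm_ge_zero[of v] norm_ge_zero[of w] by linarith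
  have t: "t > 0" using m p by (simp add: t_def)
  have "t * norm v + t * norm w < m"
    using m p t_def t by (metis add.commute distrib_left less_add_one mult.commute mult_less_cancel_left_pos nonzero_eq_divide_eq order_less_irrefl)
  then have *: "t * norm v + t * norm w < r" "t * norm v + t * norm w < d1" "t * norm v + t * norm w < d2"
    by (auto simp: m_def)
  \<comment> \<open>Both orders of differentiation compute the same second difference, at points close to \<open>x\<close>.\<close>
  obtain y1 where y1: "dist x y1 \<le> t * norm v + t * norm w"
    "f (x + t *\<^sub>R v + t *\<^sub>R w) - f (x + t *\<^sub>R v) - f (x + t *\<^sub>R w) + f x = t * t * ?E v y1 w"
    using segment_second_difference[of x r f v t w] C(1,2) r * t by blast
  obtain y2 where y2: "dist x y2 \<le> t * norm w + t * norm v"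
    "f (x + t *\<^sub>R w + t *\<^sub>R v) - f (x + t *\<^sub>R w) - f (x + t *\<^sub>R v) + f x = t * t * ?E w y2 v"
    using segment_second_difference[of x r f w t v] C(1,2) r * t
    unfolding add.commute[of "t * norm v"] by blast
  have "t * t * ?E v y1 w = t * t * ?E w y2 v"
    using y1(2) y2(2) unfolding add.assoc add.commute[of "t *\<^sub>R w"] by linarith
  then have "?E v y1 w = ?E w y2 v" using t by simp
  moreover have "\<bar>?E v y1 w - ?E v x w\<bar> < e" "\<bar>?E w y2 v - ?E w x v\<bar> < e"
    using y1 y2 * d by auto
  ultimately show False unfolding e_def by (auto simp: abs_if split: if_splits) 
qed

text \<open>The product rule for the application of \<open>D\<phi>(y)\<close> to a vector \<open>Z(y)\<close>. It is used for coordinate changes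
\<open>\<phi>\<close>, where \<open>D\<phi>\<close> transforms the components \<open>Z\<close> of a vector field.\<close>

lemma has_derivative_applied_derivative:
  fixes \<phi> :: "'a::euclidean_space \<Rightarrow> 'b::euclidean_space"
  assumes S: "open S" "x \<in> S" and \<phi>: "Ck_on 2 S \<phi>" and Z: "(Z has_derivative Z') (at x)"
  shows "((\<lambda>y. frechet_derivative \<phi> (at y) (Z y)) has_derivative
    (\<lambda>u. frechet_derivative \<phi> (at x) (Z' u) + frechet_derivative (\<lambda>y. frechet_derivative \<phi> (at y) (Z x)) (at x) u)) (at x)"
proof -
  let ?D = "\<lambda>y. frechet_derivative \<phi> (at y)"
  let ?E = "\<lambda>b. frechet_derivative (\<lambda>y. ?D y b) (at x)"
  have d: "\<phi> differentiable (at y)" if "y \<in> S" for y using \<phi> that by (auto simp: numeral_2_eq_2)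
  have d2: "((\<lambda>y. ?D y b) has_derivative ?E b) (at x)" for b
    using \<phi> S(2) by (auto simp: numeral_2_eq_2 frechet_derivative_works[symmetric])
  have sum: "((\<lambda>y. ?D y (W y)) has_derivative
      (\<lambda>u. \<Sum>b\<in>Basis. (W x \<bullet> b) *\<^sub>R ?E b u + (W' u \<bullet> b) *\<^sub>R ?D x b)) (at x)"
    if W: "(W has_derivative W') (at x)" for W W'
  proof (rule has_derivative_transform_within_open[OF _ S])
    show "((\<lambda>y. \<Sum>b\<in>Basis. (W y \<bullet> b) *\<^sub>R ?D y b) has_derivative
      (\<lambda>u. \<Sum>b\<in>Basis. (W x \<bullet> b) *\<^sub>R ?E b u + (W' u \<bullet> b) *\<^sub>R ?D x b)) (at x)"
      by (intro has_derivative_sum has_derivative_scaleR d2 has_derivative_inner_left W)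
  qed (rule frechet_derivative_expand[OF d, symmetric])
  have "((\<lambda>y. ?D y (Z x)) has_derivative (\<lambda>u. \<Sum>b\<in>Basis. (Z x \<bullet> b) *\<^sub>R ?E b u)) (at x)"
    using sum[OF has_derivative_const[of "Z x"]] by simp
  from frechet_derivative_at[OF this]
  have E: "frechet_derivative (\<lambda>y. ?D y (Z x)) (at x) = (\<lambda>u. \<Sum>b\<in>Basis. (Z x \<bullet> b) *\<^sub>R ?E b u)" by simp
  show ?thesis
    by (rule has_derivative_eq_rhs[OF sum[OF Z]])
      (simp add: E sum.distrib frechet_derivative_expand[OF d[OF S(2)], symmetric] fun_eq_iff add.commute)
qed

lemma symmetric_second_derivative_euclidean:
  fixes f :: "'a::euclidean_space \<Rightarrow> 'b::euclidean_space"
  assumes S: "open S" "x \<in> S" and f: "Ck_on 2 S f"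
  shows "frechet_derivative (\<lambda>y. frechet_derivative f (at y) v) (at x) w =
    frechet_derivative (\<lambda>y. frechet_derivative f (at y) w) (at x) v"
proof (rule euclidean_eqI)
  fix b :: 'b
  have d: "f differentiable (at y)" if "y \<in> S" for y using f that by (auto simp: numeral_2_eq_2)
  have d2: "(\<lambda>y. frechet_derivative f (at y) v) differentiable (at x)" for v
    using f S(2) by (auto simp: numeral_2_eq_2)
  have inner: "frechet_derivative (\<lambda>y. h y \<bullet> b) (at y) v = frechet_derivative h (at y) v \<bullet> b"
    if "h differentiable (at y)" for h :: "'a \<Rightarrow> 'b" and y v
    using frechet_derivative_at[OF bounded_linear.has_derivative[OF bounded_linear_inner_left[of b] that[unfolded frechet_derivative_works]]]
    by (metis (no_types))
  have E: "frechet_derivative (\<lambda>y. frechet_derivative f (at y) v) (at x) w \<bullet> b =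
    frechet_derivative (\<lambda>y. frechet_derivative (\<lambda>y. f y \<bullet> b) (at y) v) (at x) w" for v w
  proof -
    have "(\<lambda>y. frechet_derivative f (at y) v \<bullet> b) differentiable (at x)"
      by (rule differentiableI, rule bounded_linear.has_derivative[OF bounded_linear_inner_left d2[unfolded frechet_derivative_works]])
    then have "frechet_derivative (\<lambda>y. frechet_derivative f (at y) v \<bullet> b) (at x) =
        frechet_derivative (\<lambda>y. frechet_derivative (\<lambda>y. f y \<bullet> b) (at y) v) (at x)"
      by (rule frechet_derivative_transform_within_open[OF _ S]) (simp add: inner d)
    then show ?thesis using inner[OF d2, of v w] by simp
  qed
  have "Ck_on 2 S (\<lambda>y. f y \<bullet> b)"
    using f by (intro Ck_on_inner S Ck_on_const)
  from symmetric_second_derivative[OF S this]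
  show "frechet_derivative (\<lambda>y. frechet_derivative f (at y) v) (at x) w \<bullet> b =
    frechet_derivative (\<lambda>y. frechet_derivative f (at y) w) (at x) v \<bullet> b"
    unfolding E .
qed

lemma smooth_on_differentiable:
  assumes "smooth_on S f" "x \<in> S"
  shows "f differentiable (at x)"
proof -
  have "Ck_on (Suc 0) S f" using assms(1) unfolding smooth_on_def by (rule spec)
  then show ?thesis using assms(2) unfolding Ck_on.simps(2) by blast
qed

section \<open>Bump functions\<close>

text \<open>The functions \<open>t\<^sup>-\<^sup>m e\<^sup>-\<^sup>1\<^sup>/\<^sup>t\<close> for all \<open>m\<close> are treated together, because their linear span is closed under
differentiation.\<close>

definition flat_exp :: "nat \<Rightarrow> real \<Rightarrow> real" where
  "flat_exp m t = (if t > 0 then exp (- 1 / t) / t ^ m else 0)"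

lemma flat_exp_tendsto_0: "(flat_exp m \<longlongrightarrow> 0) (at 0)"
proof (rule filterlim_split_at)
  have "eventually (\<lambda>t. 0 = flat_exp m t) (at_left 0)"
    by (auto simp: flat_exp_def eventually_at_left_field intro!: exI[of _ "-1"])
  then show "(flat_exp m \<longlongrightarrow> 0) (at_left 0)"
    by (rule Lim_transform_eventually[OF tendsto_const])
  have "((\<lambda>t. inverse t ^ m / exp (inverse t)) \<longlongrightarrow> (0 :: real)) (at_right 0)"
    using filterlim_compose[OF tendsto_power_div_exp_0 filterlim_inverse_at_top_right] .
  moreover have "eventually (\<lambda>t :: real. inverse t ^ m / exp (inverse t) = flat_exp m t) (at_right 0)"
    by (auto simp: flat_exp_def eventually_at_right_field exp_minus field_simps intro!: exI[of _ 1])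
  ultimately show "(flat_exp m \<longlongrightarrow> 0) (at_right 0)"
    by (rule Lim_transform_eventually)
qed

lemma DERIV_flat_exp:
  "(flat_exp m has_real_derivative flat_exp (m + 2) t - real m * flat_exp (m + 1) t) (at t)"
proof -
  consider "t > 0" | "t < 0" | "t = 0" by linarith
  then show ?thesis
  proof cases
    case 1
    \<comment> \<open>The exponent \<open>m - 1\<close> is truncated for \<open>m = 0\<close>; then both sides vanish.\<close>
    have pm: "real m * t ^ (m - Suc 0) = real m * t ^ m / t"
      using 1 by (cases m) auto
    have "((\<lambda>t. exp (- 1 / t) / t ^ m) has_real_derivative
        (exp (- 1 / t) * (1 / t\<^sup>2) * t ^ m - exp (- 1 / t) * (real m * t ^ (m - Suc 0))) / (t ^ m * t ^ m)) (at t)"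
      using 1 by (auto intro!: derivative_eq_intros simp: power2_eq_square)
    then have "((\<lambda>t. exp (- 1 / t) / t ^ m) has_real_derivative
        flat_exp (m + 2) t - real m * flat_exp (m + 1) t) (at t)"
      unfolding pm by (rule DERIV_cong) (use 1 in \<open>auto simp: flat_exp_def field_simps power2_eq_square\<close>)
    then show ?thesis
      by (rule has_field_derivative_transform_within_open[of _ _ _ "{0<..}"]) (use 1 in \<open>auto simp: flat_exp_def\<close>)
  next
    case 2
    have "((\<lambda>t. 0) has_real_derivative flat_exp (m + 2) t - real m * flat_exp (m + 1) t) (at t)"
      using 2 by (simp add: flat_exp_def)
    then show ?thesis
      by (rule has_field_derivative_transform_within_open[of _ _ _ "{..<0}"]) (use 2 in \<open>auto simp: flat_exp_def\<close>)
  next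
    case 3
    have "(\<lambda>h. (flat_exp m (0 + h) - flat_exp m 0) / h) = flat_exp (m + 1)"
      by (auto simp: flat_exp_def fun_eq_iff)
    then show ?thesis
      using 3 flat_exp_tendsto_0[of "m + 1"] by (simp add: DERIV_def flat_exp_def)
  qed
qed

lemma Ck_on_flat_exp: "Ck_on k UNIV (flat_exp m)"
proof (induction k arbitrary: m)
  case 0
  have "isCont (flat_exp m) t" for t using DERIV_isCont[OF DERIV_flat_exp] .
  then show ?case by (simp add: continuous_at_imp_continuous_on)
next
  case (Suc k)
  have d: "(flat_exp m has_derivative (\<lambda>v. v * (flat_exp (m + 2) t + - real m * flat_exp (m + 1) t))) (at t)" for t
    using DERIV_flat_exp[of m t] unfolding has_field_derivative_def
    by (rule has_derivative_eq_rhs) (auto simp: algebra_simps)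
  show ?case
    by (rule Ck_on_SucI[OF open_UNIV d])
      (intro Ck_on_mult Ck_on_add Ck_on_const open_UNIV Suc)
qed

text \<open>Composition of \<open>e\<^sup>-\<^sup>1\<^sup>/\<^sup>t\<close>, continued by \<open>0\<close>, with \<open>r\<^sup>2 - \<parallel>x - x\<^sub>0\<parallel>\<^sup>2\<close>, which is negative outside the ball.\<close>

lemma bump_function_exists:
  fixes x0 :: "'a::euclidean_space"
  assumes "r > 0"
  shows "\<exists>\<rho> :: 'a \<Rightarrow> real. smooth_on UNIV \<rho> \<and> \<rho> x0 \<noteq> 0 \<and> (\<forall>x. x \<notin> cball x0 r \<longrightarrow> \<rho> x = 0)"
proof (intro exI conjI allI impI)
  let ?q = "\<lambda>x. r\<^sup>2 + - 1 * ((x + - x0) \<bullet> (x + - x0))"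
  let ?\<rho> = "\<lambda>x. flat_exp 0 (?q x)"
  have "Ck_on k UNIV (\<lambda>x :: 'a. x + - x0)" for k
    by (intro Ck_on_add Ck_on_const Ck_on_bounded_linear bounded_linear_ident open_UNIV)
  then have "Ck_on k UNIV ?q" for k
    by (intro Ck_on_add[OF open_UNIV Ck_on_const] Ck_on_mult[OF open_UNIV Ck_on_const] Ck_on_inner[OF open_UNIV])
  then show "smooth_on UNIV ?\<rho>"
    unfolding smooth_on_def by (auto intro!: Ck_on_compose[OF open_UNIV Ck_on_flat_exp])
  show "?\<rho> x0 \<noteq> 0" using assms by (simp add: flat_exp_def)
  fix x assume "x \<notin> cball x0 r"
  then have "r < norm (x - x0)" by (simp add: dist_norm norm_minus_commute)
  then have "r\<^sup>2 \<le> (norm (x - x0))\<^sup>2" using assms by (intro power_mono) auto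
  then show "?\<rho> x = 0" by (simp add: flat_exp_def power2_norm_eq_inner)
qed

section \<open>Partial derivatives in position and direction\<close>

text \<open>The function has a total derivative at \<open>z\<close>, with partial derivatives \<open>a\<close> in the position and \<open>c\<close> in the
direction. Total differentiability is kept as part of the notion since \<open>partial_x\<close> and \<open>partial_y\<close>
evaluate the total derivative.\<close>

definition has_partials ::
  "((real ^ 'n::finite) \<times> (real ^ 'n) \<Rightarrow> real) \<Rightarrow> (real ^ 'n) \<times> (real ^ 'n) \<Rightarrow> ('n \<Rightarrow> real) \<Rightarrow> ('n \<Rightarrow> real) \<Rightarrow> bool" where
  "has_partials f z a c \<longleftrightarrow>
     (f has_derivative (\<lambda>d. (\<Sum>k\<in>UNIV. a k * fst d $ k) + (\<Sum>k\<in>UNIV. c k * snd d $ k))) (at z)"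

lemma sum_axis: "(\<Sum>k\<in>UNIV. a k * axis i (1::real) $ k) = a (i::'n::finite)"
  by (simp add: axis_def if_distrib[of "\<lambda>x. _ * x"] cong: if_cong)

lemma has_partials_imp_partial_x: "has_partials f z a c \<Longrightarrow> partial_x i f z = a i"
  unfolding has_partials_def partial_x_def
  by (drule frechet_derivative_at, drule fun_cong[where x = "(axis i 1, 0)"]) (simp add: sum_axis)

lemma has_partials_imp_partial_y: "has_partials f z a c \<Longrightarrow> partial_y i f z = c i"
  unfolding has_partials_def partial_y_def
  by (drule frechet_derivative_at, drule fun_cong[where x = "(0, axis i 1)"]) (simp add: sum_axis)

lemma has_partials_imp_differentiable: "has_partials f z a c \<Longrightarrow> f differentiable (at z)"
  unfolding has_partials_def differentiable_def by blast

lemma linear_axis_expansion: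
  fixes L :: "real ^ 'n::finite \<Rightarrow> real"
  assumes "linear L"
  shows "L v = (\<Sum>k\<in>UNIV. L (axis k 1) * v $ k)"
proof -
  have "v = (\<Sum>k\<in>UNIV. v $ k *\<^sub>R axis k 1)"
    by (simp add: vec_eq_iff axis_def if_distrib[of "\<lambda>x. _ * x"] cong: if_cong)
  then have "L v = L (\<Sum>k\<in>UNIV. v $ k *\<^sub>R axis k 1)" by simp
  then show ?thesis using assms by (simp add: linear_sum linear_scale mult.commute)
qed

lemma differentiable_imp_has_partials:
  assumes "f differentiable (at z)"
  shows "has_partials f z (\<lambda>k. partial_x k f z) (\<lambda>k. partial_y k f z)"
proof -
  let ?L = "frechet_derivative f (at z)"
  have lin: "linear ?L" using assms by (rule linear_frechet_derivative)
  have "?L d = (\<Sum>k\<in>UNIV. ?L (axis k 1, 0) * fst d $ k) + (\<Sum>k\<in>UNIV. ?L (0, axis k 1) * snd d $ k)" for d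
  proof -
    have "linear (\<lambda>u. ?L (u, 0))" "linear (\<lambda>v. ?L (0, v))"
      by (auto intro!: linear_compose[OF _ lin, unfolded comp_def] linearI)
    then have "?L (fst d, 0) = (\<Sum>k\<in>UNIV. ?L (axis k 1, 0) * fst d $ k)"
      "?L (0, snd d) = (\<Sum>k\<in>UNIV. ?L (0, axis k 1) * snd d $ k)"
      by (auto dest: linear_axis_expansion)
    moreover have "?L d = ?L (fst d, 0) + ?L (0, snd d)"
      using linear_add[OF lin, of "(fst d, 0)" "(0, snd d)"] by simp
    ultimately show ?thesis by simp
  qed
  then have "?L = (\<lambda>d. (\<Sum>k\<in>UNIV. ?L (axis k 1, 0) * fst d $ k) + (\<Sum>k\<in>UNIV. ?L (0, axis k 1) * snd d $ k))"
    by (rule ext)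
  then show ?thesis
    using assms unfolding has_partials_def partial_x_def partial_y_def frechet_derivative_works
    by (rule subst[where P = "\<lambda>L. (f has_derivative L) (at z)"])
qed

lemma has_partials_cong_open:
  "has_partials f z a c \<Longrightarrow> open D \<Longrightarrow> z \<in> D \<Longrightarrow> (\<And>w. w \<in> D \<Longrightarrow> f w = g w) \<Longrightarrow> has_partials g z a c"
  unfolding has_partials_def by (rule has_derivative_transform_within_open)

text \<open>This holds without differentiability: \<open>frechet_derivative\<close> chooses a linear map by a condition
that depends on the germ of the function only.\<close>

lemma frechet_derivative_cong_open:
  assumes "open D" "z \<in> D" "\<And>w. w \<in> D \<Longrightarrow> f w = g w"
  shows "frechet_derivative f (at z) = frechet_derivative g (at z)"
proof -
  have "(f has_derivative L) (at z) \<longleftrightarrow> (g has_derivative L) (at z)" for L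
    using has_derivative_transform_within_open[of f L z UNIV D g]
      has_derivative_transform_within_open[of g L z UNIV D f] assms by fastforce
  then show ?thesis by (simp add: frechet_derivative_def)
qed

lemma partial_x_cong_open:
  assumes "open D" "z \<in> D" "\<And>w. w \<in> D \<Longrightarrow> f w = g w"
  shows "partial_x i f z = partial_x i g z"
  by (simp only: partial_x_def frechet_derivative_cong_open[OF assms])

lemma partial_y_cong_open:
  assumes "open D" "z \<in> D" "\<And>w. w \<in> D \<Longrightarrow> f w = g w"
  shows "partial_y i f z = partial_y i g z"
  by (simp only: partial_y_def frechet_derivative_cong_open[OF assms])

lemma has_partials_const: "has_partials (\<lambda>z. r) z (\<lambda>_. 0) (\<lambda>_. 0)"
  by (simp add: has_partials_def)

lemma has_partials_y: "has_partials (\<lambda>z. snd z $ i) z (\<lambda>_. 0) (\<lambda>k. if k = i then 1 else 0)"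
proof -
  have "bounded_linear (\<lambda>z :: (real ^ 'a) \<times> (real ^ 'a). snd z $ i)"
    by (rule bounded_linear_compose[OF bounded_linear_vec_nth bounded_linear_snd])
  from bounded_linear_imp_has_derivative[OF this] show ?thesis
    unfolding has_partials_def
    by (rule has_derivative_eq_rhs) (simp add: fun_eq_iff if_distrib[of "\<lambda>x. x * _"] cong: if_cong)
qed

lemma has_partials_x:
  assumes "\<phi> differentiable (at (fst z))"
  shows "has_partials (\<lambda>z. \<phi> (fst z)) z (\<lambda>k. frechet_derivative \<phi> (at (fst z)) (axis k 1)) (\<lambda>_. 0)"
proof -
  have "((\<lambda>z. \<phi> (fst z)) has_derivative (\<lambda>d. frechet_derivative \<phi> (at (fst z)) (fst d))) (at z)"
    using diff_chain_at[OF bounded_linear_imp_has_derivative[OF bounded_linear_fst], of \<phi> _ z] assms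
    unfolding frechet_derivative_works comp_def by blast
  then show ?thesis
    unfolding has_partials_def
    by (rule has_derivative_eq_rhs)
      (simp add: linear_axis_expansion[OF linear_frechet_derivative[OF assms], symmetric] fun_eq_iff)
qed

lemma has_partials_add:
  "has_partials f z a c \<Longrightarrow> has_partials g z a' c' \<Longrightarrow>
    has_partials (\<lambda>z. f z + g z) z (\<lambda>k. a k + a' k) (\<lambda>k. c k + c' k)"
  unfolding has_partials_def
  by (drule (1) has_derivative_add, erule has_derivative_eq_rhs)
    (simp add: fun_eq_iff distrib_right sum.distrib)

lemma has_partials_mult:
  "has_partials f z a c \<Longrightarrow> has_partials g z a' c' \<Longrightarrow>
    has_partials (\<lambda>z. f z * g z) z (\<lambda>k. a k * g z + f z * a' k) (\<lambda>k. c k * g z + f z * c' k)"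
  unfolding has_partials_def
  by (drule (1) has_derivative_mult, erule has_derivative_eq_rhs)
    (simp add: fun_eq_iff distrib_left distrib_right sum.distrib sum_distrib_left sum_distrib_right mult_ac)

lemma has_partials_cmult:
  "has_partials f z a c \<Longrightarrow> has_partials (\<lambda>z. r * f z) z (\<lambda>k. r * a k) (\<lambda>k. r * c k)"
  by (drule has_partials_mult[OF has_partials_const[of r z]]) simp

lemma has_partials_sum:
  assumes "\<And>i. i \<in> I \<Longrightarrow> has_partials (f i) z (a i) (c i)"
  shows "has_partials (\<lambda>z. \<Sum>i\<in>I. f i z) z (\<lambda>k. \<Sum>i\<in>I. a i k) (\<lambda>k. \<Sum>i\<in>I. c i k)"
  using assms
  by (induction I rule: infinite_finite_induct) (auto intro!: has_partials_const has_partials_add)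

lemma has_partials_chain:
  assumes "has_partials f z a c" "(\<phi> has_real_derivative d) (at (f z))"
  shows "has_partials (\<lambda>z. \<phi> (f z)) z (\<lambda>k. d * a k) (\<lambda>k. d * c k)"
  using diff_chain_at[OF assms(1)[unfolded has_partials_def] assms(2)[unfolded has_field_derivative_def]]
  unfolding has_partials_def comp_def
  by (rule has_derivative_eq_rhs) (simp add: fun_eq_iff distrib_left sum_distrib_left mult_ac)

lemma has_partials_eq_rhs:
  "has_partials f z a c \<Longrightarrow> (\<And>k. a k = a' k) \<Longrightarrow> (\<And>k. c k = c' k) \<Longrightarrow> has_partials f z a' c'"
  unfolding has_partials_def by simp

lemma has_partials_contract:
  assumes "\<And>m. has_partials (f m) z (a m) (c m)"
  shows "has_partials (\<lambda>z. \<Sum>m\<in>UNIV. f m z * snd z $ m) z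
    (\<lambda>k. \<Sum>m\<in>UNIV. a m k * snd z $ m) (\<lambda>k. f k z + (\<Sum>m\<in>UNIV. c m k * snd z $ m))"
proof -
  have "has_partials (\<lambda>z. \<Sum>m\<in>UNIV. f m z * snd z $ m) z
    (\<lambda>k. \<Sum>m\<in>UNIV. a m k * snd z $ m + f m z * 0)
    (\<lambda>k. \<Sum>m\<in>UNIV. c m k * snd z $ m + f m z * (if k = m then 1 else 0))"
    by (intro has_partials_sum has_partials_mult has_partials_y assms)
  then show ?thesis
    by (rule has_partials_eq_rhs) (simp_all add: sum.distrib if_distrib[of "\<lambda>x. _ * x"] cong: if_cong)
qed

lemma has_partials_linear_form:
  assumes "\<And>m. \<phi> m differentiable (at (fst z))"
  shows "has_partials (\<lambda>z. \<Sum>m\<in>UNIV. \<phi> m (fst z) * snd z $ m) z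
    (\<lambda>k. \<Sum>m\<in>UNIV. frechet_derivative (\<phi> m) (at (fst z)) (axis k 1) * snd z $ m) (\<lambda>k. \<phi> k (fst z))"
  using has_partials_contract[of "\<lambda>m z. \<phi> m (fst z)", OF has_partials_x[OF assms]] by simp

text \<open>Euler's theorem, from differentiating \<open>t \<mapsto> f(x, t y)\<close> at \<open>t = 1\<close>.\<close>

lemma Euler_homogeneous:
  assumes "f differentiable (at z)" "\<And>t. t > 0 \<Longrightarrow> f (fst z, t *\<^sub>R snd z) = t * f z"
  shows "(\<Sum>k\<in>UNIV. partial_y k f z * snd z $ k) = f z"
proof -
  have line: "((\<lambda>t. (fst z, t *\<^sub>R snd z)) has_derivative (\<lambda>d. (0, d *\<^sub>R snd z))) (at 1)"
    by (auto intro!: derivative_eq_intros)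
  have "(f has_derivative frechet_derivative f (at z)) (at (fst z, 1 *\<^sub>R snd z))"
    using assms(1) by (simp add: frechet_derivative_works)
  from diff_chain_at[OF line this]
  have "((\<lambda>t. f (fst z, t *\<^sub>R snd z)) has_derivative (\<lambda>d. frechet_derivative f (at z) (0, d *\<^sub>R snd z))) (at 1)"
    by (simp add: comp_def)
  moreover have "((\<lambda>t. f (fst z, t *\<^sub>R snd z)) has_derivative (\<lambda>d. d * f z)) (at 1)"
  proof (rule has_derivative_transform_within_open[of "\<lambda>t. t * f z" _ _ _ "{0<..}"])
    show "((\<lambda>t. t * f z) has_derivative (\<lambda>d. d * f z)) (at 1)"
      by (auto intro!: derivative_eq_intros)
  qed (use assms(2) in auto)
  ultimately have "(\<lambda>d. frechet_derivative f (at z) (0, d *\<^sub>R snd z)) = (\<lambda>d. d * f z)"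
    by (rule has_derivative_unique)
  from fun_cong[OF this, of 1] have "frechet_derivative f (at z) (0, snd z) = f z" by simp
  moreover have "frechet_derivative f (at z) =
      (\<lambda>d. (\<Sum>k\<in>UNIV. partial_x k f z * fst d $ k) + (\<Sum>k\<in>UNIV. partial_y k f z * snd d $ k))"
    using frechet_derivative_at[OF differentiable_imp_has_partials[OF assms(1), unfolded has_partials_def]] by simp
  ultimately show ?thesis by simp
qed

section \<open>Inverse matrices\<close>

lemma differentiable_det:
  fixes M :: "'a::real_normed_vector \<Rightarrow> real ^ 'n ^ 'n"
  assumes "\<And>i j. (\<lambda>x. M x $ i $ j) differentiable (at x)"
  shows "(\<lambda>x. det (M x)) differentiable (at x)"
proof -
  have "(\<lambda>x. \<Prod>i\<in>UNIV. M x $ i $ p i) differentiable (at x)" for p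
    by (rule differentiableI, rule has_derivative_prod, rule assms[unfolded frechet_derivative_works])
  then show ?thesis unfolding det_def by simp
qed

lemma
  fixes M :: "real ^ 'n ^ 'n"
  assumes "invertible M"
  shows matrix_inv_right: "M ** matrix_inv M = mat 1" and matrix_inv_left: "matrix_inv M ** M = mat 1"
  using someI_ex[OF assms[unfolded invertible_def]] by (simp_all add: matrix_inv_def)

text \<open>By Cramer's rule the entries of the inverse are rational functions of the entries of the matrix,
which shows that they depend on a parameter as differentiably as these do.\<close>

lemma matrix_inv_cramer:
  fixes M :: "real ^ 'n ^ 'n"
  assumes "invertible M"
  shows "matrix_inv M $ i $ l = det (\<chi> a j. if j = i then axis l 1 $ a else M $ a $ j) / det M"
proof -
  have "M *v (matrix_inv M *v axis l 1) = axis l 1"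
    using assms by (simp add: matrix_vector_mul_assoc matrix_inv_right)
  moreover have "det M \<noteq> 0" using assms by (simp add: invertible_det_nz)
  ultimately have "matrix_inv M *v axis l 1 = (\<chi> k. det (\<chi> a j. if j = k then axis l 1 $ a else M $ a $ j) / det M)"
    using cramer by blast
  moreover have "(matrix_inv M *v axis l 1) $ i = matrix_inv M $ i $ l"
    by (simp add: matrix_vector_mult_def sum_axis)
  ultimately show ?thesis by simp
qed

lemma differentiable_matrix_inv:
  fixes M :: "'a::real_normed_vector \<Rightarrow> real ^ 'n ^ 'n"
  assumes M: "\<And>i j. (\<lambda>x. M x $ i $ j) differentiable (at x)"
    and D: "open D" "x \<in> D" "\<And>y. y \<in> D \<Longrightarrow> invertible (M y)"
  shows "(\<lambda>x. matrix_inv (M x) $ i $ l) differentiable (at x)"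
proof -
  let ?f = "\<lambda>x. det (\<chi> a j. if j = i then axis l 1 $ a else M x $ a $ j) / det (M x)"
  have "(\<lambda>x. det (\<chi> a j. if j = i then axis l 1 $ a else M x $ a $ j)) differentiable (at x)"
  proof (rule differentiable_det)
    fix a j
    show "(\<lambda>x. (\<chi> a j. if j = i then axis l 1 $ a else M x $ a $ j) $ a $ j) differentiable (at x)"
      using M[of a j] by (cases "j = i") auto
  qed
  moreover have "(\<lambda>x. det (M x)) differentiable (at x)" using M by (rule differentiable_det)
  moreover have "det (M x) \<noteq> 0" using D by (simp add: invertible_det_nz)
  ultimately have "?f differentiable (at x)" by simp
  then obtain L where "(?f has_derivative L) (at x)" by (auto simp: differentiable_def)
  then have "((\<lambda>x. matrix_inv (M x) $ i $ l) has_derivative L) (at x)"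
    by (rule has_derivative_transform_within_open[OF _ D(1,2)]) (rule matrix_inv_cramer[OF D(3), symmetric])
  then show ?thesis by (rule differentiableI)
qed

lemma pos_def_invertible:
  fixes M :: "real ^ 'n ^ 'n"
  assumes "\<And>u. u \<noteq> 0 \<Longrightarrow> u \<bullet> (M *v u) > 0"
  shows "invertible M"
proof -
  have "u = 0" if "M *v u = 0" for u
    using assms[of u] that by force
  then show ?thesis by (simp add: invertible_left_inverse matrix_left_invertible_ker)
qed

lemma matrix_inv_symmetric:
  fixes M :: "real ^ 'n ^ 'n"
  assumes "invertible M" "transpose M = M"
  shows "matrix_inv M $ i $ j = matrix_inv M $ j $ i"
proof -
  have "transpose (matrix_inv M) ** M = mat 1"
    using assms matrix_inv_right[OF assms(1)] matrix_transpose_mul[of M "matrix_inv M"] by (simp add: transpose_mat)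
  then have "transpose (matrix_inv M) ** M ** matrix_inv M = mat 1 ** matrix_inv M" by simp
  then have "transpose (matrix_inv M) = matrix_inv M"
    using matrix_inv_right[OF assms(1)] by (simp flip: matrix_mul_assoc)
  then have "transpose (matrix_inv M) $ j $ i = matrix_inv M $ j $ i" by simp
  then show ?thesis by (simp add: transpose_def)
qed

section \<open>Locality and scaling of the fundamental tensor and the Douglas tensor\<close>

lemma fundamental_tensor_cong:
  assumes D: "open D" and eq: "\<And>w. w \<in> D \<Longrightarrow> H w = H' w" and z: "z \<in> D"
  shows "fundamental_tensor H z = fundamental_tensor H' z"
proof -
  have "partial_y j (\<lambda>w. (H w)\<^sup>2) w = partial_y j (\<lambda>w. (H' w)\<^sup>2) w" if "w \<in> D" for w j
    by (rule partial_y_cong_open[OF D that]) (simp add: eq)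
  then have "partial_y i (partial_y j (\<lambda>w. (H w)\<^sup>2)) z = partial_y i (partial_y j (\<lambda>w. (H' w)\<^sup>2)) z" for i j
    by (rule partial_y_cong_open[OF D z])
  then show ?thesis by (simp add: fundamental_tensor_def)
qed

lemma spray_coeff_cong:
  assumes D: "open D" and eq: "\<And>w. w \<in> D \<Longrightarrow> H w = H' w" and z: "z \<in> D"
  shows "spray_coeff H i z = spray_coeff H' i z"
proof -
  have 1: "partial_y j (\<lambda>w. (H w)\<^sup>2) w = partial_y j (\<lambda>w. (H' w)\<^sup>2) w" if "w \<in> D" for w j
    by (rule partial_y_cong_open[OF D that]) (simp add: eq)
  have 2: "partial_x k (partial_y j (\<lambda>w. (H w)\<^sup>2)) z = partial_x k (partial_y j (\<lambda>w. (H' w)\<^sup>2)) z" for k j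
    by (rule partial_x_cong_open[OF D z 1])
  have 3: "partial_x k (\<lambda>w. (H w)\<^sup>2) z = partial_x k (\<lambda>w. (H' w)\<^sup>2) z" for k
    by (rule partial_x_cong_open[OF D z]) (simp add: eq)
  have 0: "fundamental_tensor H z = fundamental_tensor H' z"
    by (rule fundamental_tensor_cong[OF D _ z]) (rule eq)
  show ?thesis unfolding spray_coeff_def 0 2 3 ..
qed

text \<open>A Finsler metric determines its coordinate expression over the chart image only, so the tensors must be
seen to depend on the values on an open set.\<close>

lemma douglas_tensor_cong:
  fixes H H' :: "(real ^ 'n::finite) \<times> (real ^ 'n) \<Rightarrow> real"
  assumes D: "open D" and eq: "\<And>w. w \<in> D \<Longrightarrow> H w = H' w" and z: "z \<in> D"
  shows "douglas_tensor H i j k l z = douglas_tensor H' i j k l z"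
  unfolding douglas_tensor_def
proof (rule partial_y_cong_open[OF D z], rule partial_y_cong_open[OF D], assumption,
    rule partial_y_cong_open[OF D], assumption)
  fix w assume w: "w \<in> D"
  have "partial_y m (spray_coeff H m) w = partial_y m (spray_coeff H' m) w" for m
    by (rule partial_y_cong_open[OF D w spray_coeff_cong[OF D eq]])
  then show "spray_coeff H i w - 1 / (real CARD('n) + 1) * (\<Sum>m\<in>UNIV. partial_y m (spray_coeff H m) w) * snd w $ i =
      spray_coeff H' i w - 1 / (real CARD('n) + 1) * (\<Sum>m\<in>UNIV. partial_y m (spray_coeff H' m) w) * snd w $ i"
    by (simp add: spray_coeff_cong[OF D eq w])
qed

text \<open>A factor that depends on the position only is a constant for the derivatives in \<open>y\<close>.\<close>

lemma fundamental_tensor_scale: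
  fixes H :: "(real ^ 'n::finite) \<times> (real ^ 'n) \<Rightarrow> real"
  assumes D: "open D" "z \<in> D" and H: "Ck_on 2 D H"
    and e: "\<And>w. w \<in> D \<Longrightarrow> e differentiable (at (fst w))"
  shows "fundamental_tensor (\<lambda>w. e (fst w) * H w) z = (e (fst z))\<^sup>2 *\<^sub>R fundamental_tensor H z"
proof -
  have H2: "Ck_on 2 D (\<lambda>w. (H w)\<^sup>2)"
    unfolding power2_eq_square by (intro Ck_on_mult D H)
  have d: "(\<lambda>w. (H w)\<^sup>2) differentiable (at w)" "partial_y j (\<lambda>w. (H w)\<^sup>2) differentiable (at w)" if "w \<in> D" for w j
    using H2 that unfolding partial_y_def[abs_def] by (auto simp: numeral_2_eq_2)
  have scale: "partial_y j (\<lambda>w. (e (fst w))\<^sup>2 * K w) w = (e (fst w))\<^sup>2 * partial_y j K w"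
    if w: "w \<in> D" and K: "K differentiable (at w)" for K w j
  proof -
    have "(\<lambda>x. (e x)\<^sup>2) differentiable (at (fst w))" using e[OF w] by simp
    from has_partials_imp_partial_y[OF has_partials_mult[OF has_partials_x[OF this] differentiable_imp_has_partials[OF K]]]
    show ?thesis by simp
  qed
  have "partial_y i (partial_y j (\<lambda>w. (e (fst w) * H w)\<^sup>2)) z = (e (fst z))\<^sup>2 * partial_y i (partial_y j (\<lambda>w. (H w)\<^sup>2)) z" for i j
  proof -
    have "partial_y i (partial_y j (\<lambda>w. (e (fst w) * H w)\<^sup>2)) z =
        partial_y i (\<lambda>w. (e (fst w))\<^sup>2 * partial_y j (\<lambda>w. (H w)\<^sup>2) w) z"
      by (rule partial_y_cong_open[OF D]) (simp only: power_mult_distrib scale d)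
    also have "\<dots> = (e (fst z))\<^sup>2 * partial_y i (partial_y j (\<lambda>w. (H w)\<^sup>2)) z"
      by (rule scale[OF D(2) d(2)[OF D(2)]])
    finally show ?thesis .
  qed
  then show ?thesis by (simp add: fundamental_tensor_def vec_eq_iff)
qed

section \<open>The spray of a Randers metric in coordinates\<close>

definition randers_fun ::
  "(real ^ 'n::finite \<Rightarrow> 'n \<Rightarrow> 'n \<Rightarrow> real) \<Rightarrow> (real ^ 'n \<Rightarrow> 'n \<Rightarrow> real) \<Rightarrow> (real ^ 'n) \<times> (real ^ 'n) \<Rightarrow> real" where
  "randers_fun \<gamma> b z =
     sqrt (\<Sum>l\<in>UNIV. (\<Sum>m\<in>UNIV. \<gamma> (fst z) l m * snd z $ m) * snd z $ l) + (\<Sum>j\<in>UNIV. b (fst z) j * snd z $ j)"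

text \<open>The spray is found by solving a linear system, without inverting the fundamental
tensor: it suffices to guess the solution.\<close>

lemma spray_coeff_eqI:
  assumes "invertible (fundamental_tensor H z)"
    and "\<And>l. (\<Sum>i\<in>UNIV. fundamental_tensor H z $ l $ i * G i) =
      1 / 4 * ((\<Sum>k\<in>UNIV. partial_x k (partial_y l (\<lambda>w. (H w)\<^sup>2)) z * snd z $ k)
         - partial_x l (\<lambda>w. (H w)\<^sup>2) z)"
  shows "spray_coeff H i z = G i"
proof -
  let ?M = "fundamental_tensor H z"
  have "spray_coeff H i z = (\<Sum>l\<in>UNIV. matrix_inv ?M $ i $ l * (\<Sum>i\<in>UNIV. ?M $ l $ i * G i))"
    unfolding spray_coeff_def assms(2) by (simp add: sum_distrib_left mult_ac)
  also have "\<dots> = (matrix_inv ?M *v (?M *v (\<chi> i. G i))) $ i"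
    by (simp add: matrix_vector_mult_def)
  also have "\<dots> = G i"
    by (simp add: matrix_vector_mul_assoc matrix_inv_left[OF assms(1)])
  finally show ?thesis .
qed

text \<open>A Randers metric on an open set \<open>U\<close> of coordinates, with \<open>\<gamma>\<close> the matrix of the Riemannian
metric and \<open>b\<close> the components of the 1-form. Two derivatives of the data appear, although only
first ones enter the Douglas tensor: its nested derivatives in \<open>y\<close> are taken of functions that
have to be differentiable in \<open>(x, y)\<close> jointly.\<close>

locale randers_chart =
  fixes U :: "(real ^ 'n::finite) set"
    and \<gamma> :: "real ^ 'n \<Rightarrow> 'n \<Rightarrow> 'n \<Rightarrow> real" and b :: "real ^ 'n \<Rightarrow> 'n \<Rightarrow> real"
  assumes open_U: "open U"
    and \<gamma>_C2: "\<And>i j. Ck_on 2 U (\<lambda>x. \<gamma> x i j)"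
    and \<gamma>_sym: "\<And>x i j. x \<in> U \<Longrightarrow> \<gamma> x i j = \<gamma> x j i"
    and \<gamma>_pos: "\<And>x v. x \<in> U \<Longrightarrow> v \<noteq> 0 \<Longrightarrow> (\<Sum>l\<in>UNIV. (\<Sum>m\<in>UNIV. \<gamma> x l m * v $ m) * v $ l) > 0"
    and b_C2: "\<And>i. Ck_on 2 U (\<lambda>x. b x i)"
    and H_pos: "\<And>z. z \<in> U \<times> - {0} \<Longrightarrow> randers_fun \<gamma> b z > 0"
    and H_convex: "\<And>z u. z \<in> U \<times> - {0} \<Longrightarrow> u \<noteq> 0 \<Longrightarrow>
      u \<bullet> (fundamental_tensor (randers_fun \<gamma> b) z *v u) > 0"
begin

abbreviation "D \<equiv> U \<times> (- {0} :: (real ^ 'n) set)"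
abbreviation "H \<equiv> randers_fun \<gamma> b"

text \<open>A suffix \<open>x\<close> marks the derivative in the position, with the index of the derivative last, and a suffix
\<open>0\<close> below its contraction with \<open>y\<close>. Thus \<open>low\<close> is \<open>y\<close> with its index lowered, \<open>N = \<alpha>\<^sup>2\<close>, \<open>Hx\<close> and \<open>Hy\<close> are
the first derivatives of \<open>H = \<alpha> + \<beta>\<close>, and \<open>hess\<close> is the Hessian of \<open>\<alpha>\<close> (and of \<open>H\<close>) in \<open>y\<close>.\<close>

definition "d\<gamma> i j k x = frechet_derivative (\<lambda>x. \<gamma> x i j) (at x) (axis k 1)"
definition "db j k x = frechet_derivative (\<lambda>x. b x j) (at x) (axis k 1)"
definition "low l z = (\<Sum>m\<in>UNIV. \<gamma> (fst z) l m * snd z $ m)"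
definition "lowx l k z = (\<Sum>m\<in>UNIV. d\<gamma> l m k (fst z) * snd z $ m)"
definition "N z = (\<Sum>l\<in>UNIV. low l z * snd z $ l)"
definition "Nx k z = (\<Sum>l\<in>UNIV. lowx l k z * snd z $ l)"
definition "\<alpha> z = sqrt (N z)"
definition "\<beta> z = (\<Sum>j\<in>UNIV. b (fst z) j * snd z $ j)"
definition "\<beta>x k z = (\<Sum>j\<in>UNIV. db j k (fst z) * snd z $ j)"
definition "Hy l z = low l z / \<alpha> z + b (fst z) l"
definition "Hx k z = Nx k z / (2 * \<alpha> z) + \<beta>x k z"
definition "hess l k z = \<gamma> (fst z) l k / \<alpha> z - low l z * low k z / \<alpha> z ^ 3"

lemma open_D: "open D"
  by (intro open_Times open_U open_Compl) simp

lemma H_eq: "H z = \<alpha> z + \<beta> z"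
  by (simp add: randers_fun_def \<alpha>_def N_def low_def \<beta>_def)

lemma N_pos: "z \<in> D \<Longrightarrow> N z > 0"
  using \<gamma>_pos[of "fst z" "snd z"] by (simp add: N_def low_def mem_Times_iff)

lemma \<alpha>_pos: "z \<in> D \<Longrightarrow> \<alpha> z > 0"
  using N_pos by (simp add: \<alpha>_def)

lemma \<alpha>_sq: "z \<in> D \<Longrightarrow> N z = \<alpha> z ^ 2"
  using N_pos[of z] by (simp add: \<alpha>_def)

lemma differentiable_metric_form:
  assumes "x \<in> U"
  shows "(\<lambda>x. \<gamma> x i j) differentiable (at x)" "d\<gamma> i j k differentiable (at x)"
    "(\<lambda>x. b x j) differentiable (at x)" "db j k differentiable (at x)"
  using \<gamma>_C2[of i j] b_C2[of j] assms
  by (auto simp: numeral_2_eq_2 d\<gamma>_def[abs_def] db_def[abs_def])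

lemma has_partials_low:
  "z \<in> D \<Longrightarrow> has_partials (low l) z (\<lambda>k. lowx l k z) (\<lambda>k. \<gamma> (fst z) l k)"
  unfolding low_def[abs_def] lowx_def d\<gamma>_def
  by (rule has_partials_linear_form[of "\<lambda>m x. \<gamma> x l m"]) (auto intro: differentiable_metric_form)

lemma has_partials_\<beta>:
  "z \<in> D \<Longrightarrow> has_partials \<beta> z (\<lambda>k. \<beta>x k z) (\<lambda>k. b (fst z) k)"
  unfolding \<beta>_def[abs_def] \<beta>x_def db_def
  by (rule has_partials_linear_form[of "\<lambda>m x. b x m"]) (auto intro: differentiable_metric_form)

lemma has_partials_N:
  assumes "z \<in> D"
  shows "has_partials N z (\<lambda>k. Nx k z) (\<lambda>k. 2 * low k z)"
proof -
  have "(\<Sum>i\<in>UNIV. \<gamma> (fst z) i k * snd z $ i) = low k z" for k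
    using assms \<gamma>_sym by (auto simp: low_def intro!: sum.cong)
  then show ?thesis
    using has_partials_contract[of low, OF has_partials_low[OF assms]]
    unfolding N_def[abs_def] Nx_def by simp
qed

lemma has_partials_\<alpha>:
  assumes "z \<in> D"
  shows "has_partials \<alpha> z (\<lambda>k. Nx k z / (2 * \<alpha> z)) (\<lambda>k. low k z / \<alpha> z)"
proof -
  have "(sqrt has_real_derivative inverse (sqrt (N z)) / 2) (at (N z))"
    using N_pos[OF assms] by (rule DERIV_real_sqrt)
  from has_partials_chain[OF has_partials_N[OF assms] this] show ?thesis
    unfolding \<alpha>_def[abs_def] by (rule has_partials_eq_rhs) (simp_all add: field_simps)
qed

lemma has_partials_H:
  assumes "z \<in> D"
  shows "has_partials H z (\<lambda>k. Hx k z) (\<lambda>k. Hy k z)"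
  using has_partials_add[OF has_partials_\<alpha>[OF assms] has_partials_\<beta>[OF assms]]
  unfolding H_eq[abs_def] Hx_def Hy_def .

lemma has_partials_inverse_\<alpha>:
  assumes "z \<in> D"
  shows "has_partials (\<lambda>z. inverse (\<alpha> z)) z (\<lambda>k. - Nx k z / (2 * \<alpha> z ^ 3)) (\<lambda>k. - low k z / \<alpha> z ^ 3)"
proof -
  have "\<alpha> z \<noteq> 0" using \<alpha>_pos[OF assms] by simp
  note d = DERIV_inverse[OF this]
  show ?thesis
    by (rule has_partials_eq_rhs[OF has_partials_chain[OF has_partials_\<alpha>[OF assms] d]])
      (use \<alpha>_pos[OF assms] in \<open>simp_all add: field_simps power2_eq_square power3_eq_cube\<close>)
qed

lemma has_partials_normal:
  assumes "z \<in> D"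
  shows "has_partials (\<lambda>z. low l z / \<alpha> z) z
    (\<lambda>k. lowx l k z / \<alpha> z - low l z * Nx k z / (2 * \<alpha> z ^ 3)) (\<lambda>k. hess l k z)"
  unfolding divide_inverse[of "low l _" "\<alpha> _"]
  by (rule has_partials_eq_rhs[OF has_partials_mult[OF has_partials_low[OF assms] has_partials_inverse_\<alpha>[OF assms]]])
    (simp_all add: hess_def inverse_eq_divide)

lemma has_partials_Hy:
  assumes "z \<in> D"
  shows "has_partials (Hy l) z
    (\<lambda>k. lowx l k z / \<alpha> z - low l z * Nx k z / (2 * \<alpha> z ^ 3) + db l k (fst z)) (\<lambda>k. hess l k z)"
proof -
  have "(\<lambda>x. b x l) differentiable (at (fst z))" using assms by (auto intro: differentiable_metric_form)
  note x = has_partials_x[of "\<lambda>x. b x l" z, OF this]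
  show ?thesis unfolding Hy_def[abs_def]
    by (rule has_partials_eq_rhs[OF has_partials_add[OF has_partials_normal[OF assms] x]]) (simp_all add: db_def)
qed

lemma partials_H_sq:
  assumes "z \<in> D"
  shows "partial_x k (\<lambda>w. (H w)\<^sup>2) z = 2 * (H z * Hx k z)" "partial_y k (\<lambda>w. (H w)\<^sup>2) z = 2 * (H z * Hy k z)"
proof -
  have p: "has_partials (\<lambda>w. (H w)\<^sup>2) z (\<lambda>k. 2 * (H z * Hx k z)) (\<lambda>k. 2 * (H z * Hy k z))"
    unfolding power2_eq_square
    by (rule has_partials_eq_rhs[OF has_partials_mult[OF has_partials_H[OF assms] has_partials_H[OF assms]]]) simp_all
  show "partial_x k (\<lambda>w. (H w)\<^sup>2) z = 2 * (H z * Hx k z)" "partial_y k (\<lambda>w. (H w)\<^sup>2) z = 2 * (H z * Hy k z)"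
    using has_partials_imp_partial_x[OF p] has_partials_imp_partial_y[OF p] by simp_all
qed

lemma has_partials_partial_H_sq:
  assumes "z \<in> D"
  shows "has_partials (partial_y l (\<lambda>w. (H w)\<^sup>2)) z
    (\<lambda>k. 2 * (Hx k z * Hy l z + H z * (lowx l k z / \<alpha> z - low l z * Nx k z / (2 * \<alpha> z ^ 3) + db l k (fst z))))
    (\<lambda>k. 2 * (Hy k z * Hy l z + H z * hess l k z))"
  by (rule has_partials_cong_open[OF has_partials_cmult[OF has_partials_mult[OF has_partials_H[OF assms] has_partials_Hy[OF assms]]]
      open_D assms partials_H_sq(2)[symmetric]])

text \<open>The Hessian of \<open>H\<^sup>2/2\<close> is \<open>Hy Hy + H \<cdot> hess\<close>, where only the Riemannian part contributes to \<open>hess\<close>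
because \<open>\<beta>\<close> is linear in \<open>y\<close>.\<close>

lemma fundamental_tensor_H:
  assumes "z \<in> D"
  shows "fundamental_tensor H z $ l $ i = Hy l z * Hy i z + H z * hess l i z"
  using assms \<gamma>_sym[of "fst z" i l] unfolding fundamental_tensor_def
  by (auto simp: has_partials_imp_partial_y[OF has_partials_partial_H_sq[OF assms]] hess_def mult_ac)

lemma partial_x_partial_y_H_sq:
  assumes "z \<in> D"
  shows "partial_x k (partial_y l (\<lambda>w. (H w)\<^sup>2)) z =
    2 * (Hx k z * Hy l z + H z * (lowx l k z / \<alpha> z - low l z * Nx k z / (2 * \<alpha> z ^ 3) + db l k (fst z)))"
  using has_partials_imp_partial_x[OF has_partials_partial_H_sq[OF assms]] .

text \<open>\<open>\<Gamma>\<close> is the spray of \<open>\<gamma>\<close>. Its coefficients \<open>geo\<close> become half of the Christoffel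
symbols when they are symmetrized in the lower indices. The 2-form \<open>curl\<close> is the exterior
derivative of the 1-form, and \<open>curl_vec\<close> its contraction with \<open>y\<close>, with the index raised. The coefficient
\<open>P\<close> of \<open>y\<close> is what the component of the linear system along \<open>y\<close> forces it to be.\<close>

definition "ginv x i l = matrix_inv (\<chi> i j. \<gamma> x i j) $ i $ l"
definition "geo i m k x = (\<Sum>l\<in>UNIV. ginv x i l * (1 / 2 * (d\<gamma> l m k x - 1 / 2 * d\<gamma> k m l x)))"
definition "\<Gamma> i z = (\<Sum>m\<in>UNIV. (\<Sum>k\<in>UNIV. geo i m k (fst z) * snd z $ k) * snd z $ m)"
definition "curl k l x = db l k x - db k l x"
definition "curl_up i k x = (\<Sum>l\<in>UNIV. ginv x i l * curl k l x)"
definition "curl_vec i z = (\<Sum>k\<in>UNIV. curl_up i k (fst z) * snd z $ k)"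
definition "lowx0 l z = (\<Sum>k\<in>UNIV. lowx l k z * snd z $ k)"
definition "N0 z = (\<Sum>k\<in>UNIV. Nx k z * snd z $ k)"
definition "\<beta>0 z = (\<Sum>k\<in>UNIV. \<beta>x k z * snd z $ k)"
definition "b\<Gamma> z = (\<Sum>i\<in>UNIV. b (fst z) i * \<Gamma> i z)"
definition "b_curl z = (\<Sum>i\<in>UNIV. b (fst z) i * curl_vec i z)"
definition "P z = (1 / 2 * \<beta>0 z - b\<Gamma> z - \<alpha> z / 2 * b_curl z) / H z"
definition "G i z = \<Gamma> i z + P z * snd z $ i + 1 / 2 * (\<alpha> z * curl_vec i z)"

lemma inner_\<gamma>:
  "v \<bullet> ((\<chi> i j. \<gamma> x i j) *v v) = (\<Sum>l\<in>UNIV. (\<Sum>m\<in>UNIV. \<gamma> x l m * v $ m) * v $ l)"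
  by (simp add: inner_vec_def matrix_vector_mult_def mult.commute)

lemma invertible_\<gamma>: "x \<in> U \<Longrightarrow> invertible (\<chi> i j. \<gamma> x i j)"
  by (rule pos_def_invertible) (simp add: inner_\<gamma> \<gamma>_pos)

lemma ginv_right:
  assumes "x \<in> U"
  shows "(\<Sum>l\<in>UNIV. \<gamma> x i l * ginv x l j) = (if i = j then 1 else 0)"
proof -
  have "((\<chi> i j. \<gamma> x i j) ** matrix_inv (\<chi> i j. \<gamma> x i j)) $ i $ j = mat 1 $ i $ j"
    using matrix_inv_right[OF invertible_\<gamma>[OF assms]] by simp
  then show ?thesis by (simp add: matrix_matrix_mult_def ginv_def mat_def)
qed

lemma ginv_sym: "x \<in> U \<Longrightarrow> ginv x i j = ginv x j i"
  unfolding ginv_def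
  by (rule matrix_inv_symmetric[OF invertible_\<gamma>]) (auto simp: transpose_def vec_eq_iff \<gamma>_sym)

lemma ginv_differentiable:
  assumes "x \<in> U"
  shows "(\<lambda>x. ginv x i l) differentiable (at x)"
  unfolding ginv_def
  by (rule differentiable_matrix_inv[OF _ open_U assms invertible_\<gamma>])
    (simp_all add: differentiable_metric_form[OF assms])

lemma lower_raise:
  assumes "x \<in> U"
  shows "(\<Sum>i\<in>UNIV. \<gamma> x l i * (\<Sum>m\<in>UNIV. ginv x i m * c m)) = c l"
proof -
  have "(\<Sum>i\<in>UNIV. \<gamma> x l i * (\<Sum>m\<in>UNIV. ginv x i m * c m)) = (\<Sum>i\<in>UNIV. \<Sum>m\<in>UNIV. \<gamma> x l i * ginv x i m * c m)"
    by (simp add: sum_distrib_left mult.assoc)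
  also have "\<dots> = (\<Sum>m\<in>UNIV. (\<Sum>i\<in>UNIV. \<gamma> x l i * ginv x i m) * c m)"
    by (subst sum.swap) (simp add: sum_distrib_right)
  also have "\<dots> = c l"
    by (simp add: ginv_right[OF assms] if_distrib[of "\<lambda>x. x * _"] cong: if_cong)
  finally show ?thesis .
qed

lemma geo_differentiable: "x \<in> U \<Longrightarrow> geo i m k differentiable (at x)"
  unfolding geo_def[abs_def]
  by (intro differentiable_sum differentiable_mult differentiable_diff differentiable_const ballI
      ginv_differentiable differentiable_metric_form finite)

lemma curl_up_differentiable: "x \<in> U \<Longrightarrow> curl_up i k differentiable (at x)"
  unfolding curl_up_def[abs_def] curl_def[abs_def]
  by (intro differentiable_sum differentiable_mult differentiable_diff ballI
      ginv_differentiable differentiable_metric_form finite)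

lemma \<Gamma>_raise: "\<Gamma> i z = (\<Sum>l\<in>UNIV. ginv (fst z) i l * (1 / 2 * (lowx0 l z - 1 / 2 * Nx l z)))"
proof -
  let ?x = "fst z" and ?y = "snd z"
  have "lowx0 l z = (\<Sum>m\<in>UNIV. \<Sum>k\<in>UNIV. d\<gamma> l m k ?x * (?y $ k * ?y $ m))" for l
    unfolding lowx0_def lowx_def sum_distrib_right
    by (subst sum.swap) (simp add: mult_ac)
  moreover have "Nx l z = (\<Sum>m\<in>UNIV. \<Sum>k\<in>UNIV. d\<gamma> k m l ?x * (?y $ k * ?y $ m))" for l
    unfolding Nx_def lowx_def sum_distrib_right
    by (subst sum.swap) (simp add: mult_ac)
  ultimately have "lowx0 l z - 1 / 2 * Nx l z =
      (\<Sum>m\<in>UNIV. \<Sum>k\<in>UNIV. (d\<gamma> l m k ?x - 1 / 2 * d\<gamma> k m l ?x) * (?y $ k * ?y $ m))" for l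
    by (simp add: sum_distrib_left sum_subtractf[symmetric] left_diff_distrib)
  then have "(\<Sum>l\<in>UNIV. ginv ?x i l * (1 / 2 * (lowx0 l z - 1 / 2 * Nx l z))) =
      (\<Sum>l\<in>UNIV. \<Sum>m\<in>UNIV. \<Sum>k\<in>UNIV. ginv ?x i l * (1 / 2 * (d\<gamma> l m k ?x - 1 / 2 * d\<gamma> k m l ?x)) * (?y $ k * ?y $ m))"
    by (simp add: sum_distrib_left mult_ac)
  also have "\<dots> = (\<Sum>m\<in>UNIV. \<Sum>l\<in>UNIV. \<Sum>k\<in>UNIV. ginv ?x i l * (1 / 2 * (d\<gamma> l m k ?x - 1 / 2 * d\<gamma> k m l ?x)) * (?y $ k * ?y $ m))"
    by (rule sum.swap)
  also have "\<dots> = (\<Sum>m\<in>UNIV. \<Sum>k\<in>UNIV. \<Sum>l\<in>UNIV. ginv ?x i l * (1 / 2 * (d\<gamma> l m k ?x - 1 / 2 * d\<gamma> k m l ?x)) * (?y $ k * ?y $ m))"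
    by (intro sum.cong refl sum.swap)
  also have "\<dots> = \<Gamma> i z"
    unfolding \<Gamma>_def geo_def sum_distrib_right by (simp add: mult_ac)
  finally show ?thesis by simp
qed

lemma lower_\<Gamma>: "z \<in> D \<Longrightarrow> (\<Sum>i\<in>UNIV. \<gamma> (fst z) l i * \<Gamma> i z) = 1 / 2 * (lowx0 l z - 1 / 2 * Nx l z)"
  unfolding \<Gamma>_raise by (rule lower_raise) auto

lemma curl_vec_raise: "curl_vec i z = (\<Sum>l\<in>UNIV. ginv (fst z) i l * (\<Sum>k\<in>UNIV. curl k l (fst z) * snd z $ k))"
  unfolding curl_vec_def curl_up_def sum_distrib_right sum_distrib_left
  by (subst sum.swap) (simp add: mult_ac)

lemma lower_curl_vec:
  assumes "z \<in> D"
  shows "(\<Sum>i\<in>UNIV. \<gamma> (fst z) l i * curl_vec i z) = (\<Sum>k\<in>UNIV. db l k (fst z) * snd z $ k) - \<beta>x l z"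
proof -
  have "(\<Sum>i\<in>UNIV. \<gamma> (fst z) l i * curl_vec i z) = (\<Sum>k\<in>UNIV. curl k l (fst z) * snd z $ k)"
    unfolding curl_vec_raise by (rule lower_raise) (use assms in auto)
  then show ?thesis
    by (simp add: curl_def \<beta>x_def left_diff_distrib sum_subtractf)
qed

text \<open>The symmetry of \<open>\<gamma>\<close> moves the lowering of the index from \<open>y\<close> to the other vector.\<close>

lemma low_contract:
  assumes "z \<in> D"
  shows "(\<Sum>i\<in>UNIV. low i z * c i) = (\<Sum>l\<in>UNIV. (\<Sum>i\<in>UNIV. \<gamma> (fst z) l i * c i) * snd z $ l)"
proof -
  have "(\<Sum>i\<in>UNIV. low i z * c i) = (\<Sum>l\<in>UNIV. \<Sum>i\<in>UNIV. \<gamma> (fst z) i l * snd z $ l * c i)"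
    unfolding low_def sum_distrib_right by (rule sum.swap)
  also have "\<dots> = (\<Sum>l\<in>UNIV. (\<Sum>i\<in>UNIV. \<gamma> (fst z) l i * c i) * snd z $ l)"
    using assms \<gamma>_sym unfolding sum_distrib_right by (auto intro!: sum.cong)
  finally show ?thesis .
qed

text \<open>Together with \<open>low_curl_vec\<close> this gives the pairing of the spray with \<open>y\<close>, which enters the linear
system through the rank-one part of \<open>hess\<close>.\<close>

lemma low_\<Gamma>:
  assumes "z \<in> D"
  shows "(\<Sum>i\<in>UNIV. low i z * \<Gamma> i z) = N0 z / 4"
proof -
  have "(\<Sum>l\<in>UNIV. lowx0 l z * snd z $ l) = N0 z"
    unfolding lowx0_def N0_def Nx_def sum_distrib_right
    by (subst sum.swap) (simp add: mult_ac)
  then show ?thesis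
    unfolding low_contract[OF assms] lower_\<Gamma>[OF assms]
    by (simp add: N0_def left_diff_distrib sum_subtractf flip: sum_distrib_left sum_divide_distrib)
qed

text \<open>A 2-form vanishes on the pair \<open>(y, y)\<close>.\<close>

lemma low_curl_vec:
  assumes "z \<in> D"
  shows "(\<Sum>i\<in>UNIV. low i z * curl_vec i z) = 0"
proof -
  have "(\<Sum>l\<in>UNIV. (\<Sum>k\<in>UNIV. db l k (fst z) * snd z $ k) * snd z $ l) = (\<Sum>l\<in>UNIV. \<beta>x l z * snd z $ l)"
    unfolding \<beta>x_def sum_distrib_right by (subst sum.swap) (simp add: mult_ac)
  then show ?thesis
    unfolding low_contract[OF assms] lower_curl_vec[OF assms] by (simp add: left_diff_distrib sum_subtractf)
qed

lemma low_y: "z \<in> D \<Longrightarrow> (\<Sum>i\<in>UNIV. low i z * snd z $ i) = \<alpha> z ^ 2"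
  using \<alpha>_sq by (simp add: N_def)

lemma sum_G:
  "(\<Sum>i\<in>UNIV. c i * G i z) = (\<Sum>i\<in>UNIV. c i * \<Gamma> i z) + P z * (\<Sum>i\<in>UNIV. c i * snd z $ i)
     + \<alpha> z / 2 * (\<Sum>i\<in>UNIV. c i * curl_vec i z)"
  by (simp add: G_def distrib_left sum.distrib sum_distrib_left mult_ac)

text \<open>The system reads \<open>Hy\<^sub>l (Hy\<^sub>i G\<^sup>i) + H (hess\<^sub>l\<^sub>i G\<^sup>i) = Hy\<^sub>l (\<partial>\<^sub>k H y\<^sup>k)/2 + H (\<partial>\<^sub>k Hy\<^sub>l y\<^sup>k - \<partial>\<^sub>l H)/2\<close>, and it is
solved by matching the two brackets separately. Since \<open>hess\<close> annihilates \<open>y\<close>, the second one does not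
see \<open>P\<close>: the term \<open>\<Gamma>\<close> accounts for \<open>\<alpha>\<close> and the term \<open>(\<alpha>/2) curl_vec\<close> for \<open>\<beta>\<close>. The first one determines \<open>P\<close>,
because \<open>Hy\<^sub>i y\<^sup>i = H\<close>.\<close>

lemma spray_coeff_H:
  assumes "z \<in> D"
  shows "spray_coeff H i z = G i z"
proof (rule spray_coeff_eqI)
  show "invertible (fundamental_tensor H z)"
    using H_convex[OF assms] by (rule pos_def_invertible)
next
  fix l
  let ?a = "\<alpha> z" and ?B = "\<Sum>k\<in>UNIV. db l k (fst z) * snd z $ k"
  have a: "?a \<noteq> 0" and H0: "H z \<noteq> 0" using \<alpha>_pos[OF assms] H_pos[OF assms] by auto
  have PH: "P z * H z = 1 / 2 * \<beta>0 z - b\<Gamma> z - ?a / 2 * b_curl z" using H0 by (simp add: P_def)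
  have pG: "(\<Sum>i\<in>UNIV. low i z * G i z) = N0 z / 4 + P z * ?a ^ 2"
    unfolding sum_G low_\<Gamma>[OF assms] low_curl_vec[OF assms] low_y[OF assms] by simp
  have bG: "(\<Sum>i\<in>UNIV. b (fst z) i * G i z) = b\<Gamma> z + P z * \<beta> z + ?a / 2 * b_curl z"
    unfolding sum_G by (simp add: b\<Gamma>_def b_curl_def \<beta>_def)
  have gG: "(\<Sum>i\<in>UNIV. \<gamma> (fst z) l i * G i z) =
      1 / 2 * (lowx0 l z - 1 / 2 * Nx l z) + P z * low l z + ?a / 2 * (?B - \<beta>x l z)"
    unfolding sum_G lower_\<Gamma>[OF assms] lower_curl_vec[OF assms] by (simp add: low_def)
  have "(\<Sum>i\<in>UNIV. Hy i z * G i z) = (\<Sum>i\<in>UNIV. low i z * G i z) / ?a + (\<Sum>i\<in>UNIV. b (fst z) i * G i z)"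
    by (simp add: Hy_def distrib_right sum.distrib sum_divide_distrib)
  also have "\<dots> = N0 z / (4 * ?a) + P z * H z + b\<Gamma> z + ?a / 2 * b_curl z"
    unfolding pG bG H_eq using a by (simp add: field_simps power2_eq_square)
  finally have hG: "(\<Sum>i\<in>UNIV. Hy i z * G i z) = N0 z / (4 * ?a) + \<beta>0 z / 2"
    unfolding PH by simp
  have "(\<Sum>i\<in>UNIV. hess l i z * G i z) =
      (\<Sum>i\<in>UNIV. \<gamma> (fst z) l i * G i z) / ?a - low l z * (\<Sum>i\<in>UNIV. low i z * G i z) / ?a ^ 3"
    unfolding sum_divide_distrib sum_distrib_left sum_subtractf[symmetric]
    by (simp add: hess_def left_diff_distrib mult.assoc)
  also have "\<dots> = lowx0 l z / (2 * ?a) - Nx l z / (4 * ?a) + (?B - \<beta>x l z) / 2 - low l z * N0 z / (4 * ?a ^ 3)"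
    unfolding pG gG using a by (simp add: field_simps power2_eq_square power3_eq_cube)
  finally have aG: "(\<Sum>i\<in>UNIV. hess l i z * G i z) =
      lowx0 l z / (2 * ?a) - Nx l z / (4 * ?a) + (?B - \<beta>x l z) / 2 - low l z * N0 z / (4 * ?a ^ 3)" .
  have L: "(\<Sum>i\<in>UNIV. fundamental_tensor H z $ l $ i * G i z) =
      Hy l z * (\<Sum>i\<in>UNIV. Hy i z * G i z) + H z * (\<Sum>i\<in>UNIV. hess l i z * G i z)"
    unfolding fundamental_tensor_H[OF assms] sum_distrib_left sum.distrib[symmetric]
    by (intro sum.cong refl) (simp add: algebra_simps)
  have R1: "(\<Sum>k\<in>UNIV. Hx k z * snd z $ k) = N0 z / (2 * ?a) + \<beta>0 z"
    by (simp add: Hx_def N0_def \<beta>0_def distrib_right sum.distrib sum_divide_distrib)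
  have R2: "(\<Sum>k\<in>UNIV. (lowx l k z / ?a - low l z * Nx k z / (2 * ?a ^ 3) + db l k (fst z)) * snd z $ k) =
      lowx0 l z / ?a - low l z * N0 z / (2 * ?a ^ 3) + ?B"
    unfolding lowx0_def N0_def sum_divide_distrib sum_distrib_left sum.distrib[symmetric] sum_subtractf[symmetric]
    by (intro sum.cong refl) (simp add: algebra_simps)
  have R: "(\<Sum>k\<in>UNIV. partial_x k (partial_y l (\<lambda>w. (H w)\<^sup>2)) z * snd z $ k) =
      2 * (Hy l z * (N0 z / (2 * ?a) + \<beta>0 z) + H z * (lowx0 l z / ?a - low l z * N0 z / (2 * ?a ^ 3) + ?B))"
    unfolding partial_x_partial_y_H_sq[OF assms] R1[symmetric] R2[symmetric] sum_distrib_left sum.distrib[symmetric]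
    by (intro sum.cong refl) (simp add: distrib_left distrib_right mult_ac)
  show "(\<Sum>i\<in>UNIV. fundamental_tensor H z $ l $ i * G i z) =
      1 / 4 * ((\<Sum>k\<in>UNIV. partial_x k (partial_y l (\<lambda>w. (H w)\<^sup>2)) z * snd z $ k) - partial_x l (\<lambda>w. (H w)\<^sup>2) z)"
    unfolding L R hG aG partials_H_sq(1)[OF assms] Hx_def by (simp add: field_simps)
qed

section \<open>The Douglas tensor of a Randers metric in coordinates\<close>

text \<open>Derivatives in the position are only asserted to exist here: \<open>partial_y\<close> evaluates a total derivative, so
joint differentiability has to be recorded along with the derivatives in \<open>y\<close>.\<close>

lemma has_partials_\<Gamma>:
  assumes "z \<in> D"
  shows "\<exists>a. has_partials (\<Gamma> i) z a (\<lambda>k. (\<Sum>j\<in>UNIV. geo i k j (fst z) * snd z $ j) + (\<Sum>j\<in>UNIV. geo i j k (fst z) * snd z $ j))"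
proof -
  have "geo i m k differentiable (at (fst z))" for m k using assms by (auto intro: geo_differentiable)
  then show ?thesis
    unfolding \<Gamma>_def[abs_def]
    by (intro exI) (rule has_partials_contract, rule has_partials_linear_form)
qed

lemma has_partials_curl_vec:
  assumes "z \<in> D"
  shows "\<exists>a. has_partials (curl_vec i) z a (\<lambda>k. curl_up i k (fst z))"
proof -
  have "curl_up i k differentiable (at (fst z))" for k using assms by (auto intro: curl_up_differentiable)
  then show ?thesis
    unfolding curl_vec_def[abs_def] by (intro exI) (rule has_partials_linear_form)
qed

lemma differentiable_P:
  assumes "z \<in> D"
  shows "P differentiable (at z)"
proof -
  have b: "(\<lambda>z. b (fst z) i) differentiable (at z)" for i
    by (rule has_partials_imp_differentiable[OF has_partials_x[of "\<lambda>x. b x i"]])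
      (use assms in \<open>auto intro: differentiable_metric_form\<close>)
  have "(\<lambda>z. \<Sum>m\<in>UNIV. db m k (fst z) * snd z $ m) differentiable (at z)" for k
    by (rule has_partials_imp_differentiable[OF has_partials_linear_form])
      (use assms in \<open>auto intro: differentiable_metric_form\<close>)
  then have \<beta>x: "\<beta>x k differentiable (at z)" for k unfolding \<beta>x_def[abs_def] .
  have y: "(\<lambda>z. snd z $ k) differentiable (at z)" for k
    by (rule has_partials_imp_differentiable[OF has_partials_y])
  have "\<Gamma> i differentiable (at z)" "curl_vec i differentiable (at z)" for i
    using has_partials_\<Gamma>[OF assms] has_partials_curl_vec[OF assms] has_partials_imp_differentiable by blast+
  moreover have "\<alpha> differentiable (at z)" "H differentiable (at z)"
    using has_partials_\<alpha>[OF assms] has_partials_H[OF assms] has_partials_imp_differentiable by blast+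
  moreover have "H z \<noteq> 0" using H_pos[OF assms] by simp
  ultimately show ?thesis
    unfolding P_def[abs_def] b\<Gamma>_def b_curl_def \<beta>0_def divide_inverse
    using b \<beta>x y
    by (intro differentiable_mult differentiable_diff differentiable_sum differentiable_inverse
        differentiable_const ballI finite)
qed

text \<open>Numerator and denominator of \<open>P\<close> have degrees 2 and 1 in \<open>y\<close>.\<close>

lemma P_homogeneous:
  assumes "z \<in> D" "t > 0"
  shows "P (fst z, t *\<^sub>R snd z) = t * P z"
proof -
  let ?z = "(fst z, t *\<^sub>R snd z)"
  have low: "low l ?z = t * low l z" for l by (simp add: low_def sum_distrib_left mult_ac)
  have "N ?z = t\<^sup>2 * N z" by (simp add: N_def low sum_distrib_left power2_eq_square mult_ac)
  then have \<alpha>: "\<alpha> ?z = t * \<alpha> z" using assms(2) by (simp add: \<alpha>_def real_sqrt_mult)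
  have \<beta>: "\<beta> ?z = t * \<beta> z" by (simp add: \<beta>_def sum_distrib_left mult_ac)
  have \<beta>x: "\<beta>x k ?z = t * \<beta>x k z" for k by (simp add: \<beta>x_def sum_distrib_left mult_ac)
  have \<Gamma>: "\<Gamma> i ?z = t\<^sup>2 * \<Gamma> i z" for i
    by (simp add: \<Gamma>_def sum_distrib_left sum_distrib_right power2_eq_square mult_ac)
  have w: "curl_vec i ?z = t * curl_vec i z" for i by (simp add: curl_vec_def sum_distrib_left mult_ac)
  have \<beta>0: "\<beta>0 ?z = t\<^sup>2 * \<beta>0 z" by (simp add: \<beta>0_def \<beta>x sum_distrib_left power2_eq_square mult_ac)
  have b\<Gamma>: "b\<Gamma> ?z = t\<^sup>2 * b\<Gamma> z" by (simp add: b\<Gamma>_def \<Gamma> sum_distrib_left mult_ac)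
  have b_curl: "b_curl ?z = t * b_curl z" by (simp add: b_curl_def w sum_distrib_left mult_ac)
  have "1 / 2 * (t\<^sup>2 * \<beta>0 z) - t\<^sup>2 * b\<Gamma> z - t * \<alpha> z / 2 * (t * b_curl z) =
      t * (t * (1 / 2 * \<beta>0 z - b\<Gamma> z - \<alpha> z / 2 * b_curl z))"
    by (simp add: algebra_simps power2_eq_square)
  then show ?thesis
    using assms(2) unfolding P_def H_eq \<alpha> \<beta> \<beta>0 b\<Gamma> b_curl distrib_left[symmetric] by simp
qed

lemma Euler_P:
  assumes "z \<in> D"
  shows "(\<Sum>k\<in>UNIV. partial_y k P z * snd z $ k) = P z"
  by (rule Euler_homogeneous[OF differentiable_P[OF assms] P_homogeneous[OF assms]])

lemma partial_y_spray:
  assumes "z \<in> D"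
  shows "partial_y k (spray_coeff H i) z =
    ((\<Sum>j\<in>UNIV. geo i k j (fst z) * snd z $ j) + (\<Sum>j\<in>UNIV. geo i j k (fst z) * snd z $ j))
    + (partial_y k P z * snd z $ i + (if k = i then P z else 0))
    + 1 / 2 * (low k z / \<alpha> z * curl_vec i z + \<alpha> z * curl_up i k (fst z))"
proof -
  obtain a1 where a1: "has_partials (\<Gamma> i) z a1
      (\<lambda>k. (\<Sum>j\<in>UNIV. geo i k j (fst z) * snd z $ j) + (\<Sum>j\<in>UNIV. geo i j k (fst z) * snd z $ j))"
    using has_partials_\<Gamma>[OF assms] by blast
  obtain hess where hess: "has_partials (curl_vec i) z hess (\<lambda>k. curl_up i k (fst z))"
    using has_partials_curl_vec[OF assms] by blast
  have "partial_y k (spray_coeff H i) z = partial_y k (G i) z"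
    by (rule partial_y_cong_open[OF open_D assms spray_coeff_H])
  also have "\<dots> = ((\<Sum>j\<in>UNIV. geo i k j (fst z) * snd z $ j) + (\<Sum>j\<in>UNIV. geo i j k (fst z) * snd z $ j))
    + (partial_y k P z * snd z $ i + P z * (if k = i then 1 else 0))
    + 1 / 2 * (low k z / \<alpha> z * curl_vec i z + \<alpha> z * curl_up i k (fst z))"
    unfolding G_def[abs_def]
    by (rule has_partials_imp_partial_y[OF has_partials_add[OF has_partials_add[OF a1
          has_partials_mult[OF differentiable_imp_has_partials[OF differentiable_P[OF assms]] has_partials_y]]
          has_partials_cmult[OF has_partials_mult[OF has_partials_\<alpha>[OF assms] hess]]]])
  finally show ?thesis by simp
qed

definition "geo_trace k x = (\<Sum>m\<in>UNIV. geo m m k x + geo m k m x)"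

text \<open>The trace of a symmetric form against a skew one vanishes.\<close>

lemma trace_curl_up:
  assumes "x \<in> U"
  shows "(\<Sum>m\<in>UNIV. curl_up m m x) = 0"
proof -
  have "(\<Sum>m\<in>UNIV. curl_up m m x) = (\<Sum>m\<in>UNIV. \<Sum>l\<in>UNIV. ginv x m l * curl m l x)"
    by (simp add: curl_up_def)
  also have "\<dots> = (\<Sum>m\<in>UNIV. \<Sum>l\<in>UNIV. ginv x l m * curl l m x)"
    by (rule sum.swap)
  also have "\<dots> = (\<Sum>m\<in>UNIV. \<Sum>l\<in>UNIV. - (ginv x m l * curl m l x))"
    using ginv_sym[OF assms] by (intro sum.cong refl) (simp add: curl_def algebra_simps)
  finally show ?thesis by (simp add: sum_negf curl_up_def)
qed

text \<open>\<open>\<partial>\<^sub>m (P y\<^sup>m) = (n + 1) P\<close> by Euler's theorem, which explains the factor \<open>1/(n + 1)\<close> in the Douglas tensor,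
and \<open>\<partial>\<^sub>m (\<alpha> w\<^sup>m)\<close> vanishes by \<open>low_curl_vec\<close> and \<open>trace_curl_up\<close>.\<close>

lemma divergence_spray:
  assumes "z \<in> D"
  shows "(\<Sum>m\<in>UNIV. partial_y m (spray_coeff H m) z) =
    (\<Sum>k\<in>UNIV. geo_trace k (fst z) * snd z $ k) + (real CARD('n) + 1) * P z"
proof -
  have "fst z \<in> U" using assms by auto
  have "(\<Sum>m\<in>UNIV. (\<Sum>j\<in>UNIV. geo m m j (fst z) * snd z $ j) + (\<Sum>j\<in>UNIV. geo m j m (fst z) * snd z $ j)) =
      (\<Sum>m\<in>UNIV. \<Sum>j\<in>UNIV. (geo m m j (fst z) + geo m j m (fst z)) * snd z $ j)"
    by (simp add: sum.distrib distrib_right)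
  also have "\<dots> = (\<Sum>k\<in>UNIV. geo_trace k (fst z) * snd z $ k)"
    unfolding geo_trace_def sum_distrib_right by (rule sum.swap)
  finally have 1: "(\<Sum>m\<in>UNIV. (\<Sum>j\<in>UNIV. geo m m j (fst z) * snd z $ j) + (\<Sum>j\<in>UNIV. geo m j m (fst z) * snd z $ j)) =
      (\<Sum>k\<in>UNIV. geo_trace k (fst z) * snd z $ k)" .
  have "(\<Sum>m\<in>UNIV. low m z / \<alpha> z * curl_vec m z) = 0"
    using low_curl_vec[OF assms] by (simp flip: sum_divide_distrib)
  then have 2: "(\<Sum>m\<in>UNIV. 1 / 2 * (low m z / \<alpha> z * curl_vec m z + \<alpha> z * curl_up m m (fst z))) = 0"
    using trace_curl_up[OF \<open>fst z \<in> U\<close>]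
    by (simp only: sum_distrib_left[symmetric] sum.distrib) simp
  have 3: "(\<Sum>m\<in>UNIV. partial_y m P z * snd z $ m + (if m = m then P z else 0)) = (real CARD('n) + 1) * P z"
    using Euler_P[OF assms] by (simp add: sum.distrib algebra_simps)
  show ?thesis
    unfolding partial_y_spray[OF assms] sum.distrib[of "\<lambda>m. _ m + (partial_y m P z * snd z $ m + _ m)"]
      sum.distrib[of _ "\<lambda>m. partial_y m P z * snd z $ m + _ m"] 1 2 3 by simp
qed

text \<open>The coefficients of the quadratic part that remains after the divergence has been subtracted.\<close>

definition "Q i m k x = geo i m k x - 1 / (real CARD('n) + 1) * (if i = m then geo_trace k x else 0)"

lemma Q_differentiable:
  assumes "x \<in> U"
  shows "Q i m k differentiable (at x)"
proof -
  have "geo_trace k differentiable (at x)"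
    unfolding geo_trace_def[abs_def]
    by (intro differentiable_sum differentiable_add ballI finite) (rule geo_differentiable[OF assms])+
  then show ?thesis unfolding Q_def[abs_def]
    by (cases "i = m") (auto intro!: differentiable_diff geo_differentiable[OF assms])
qed

text \<open>The term \<open>P y\<^sup>i\<close> has cancelled. What remains is a quadratic form in \<open>y\<close>, which three derivatives
annihilate, and \<open>(\<alpha>/2) curl_vec\<close>.\<close>

lemma douglas_argument:
  assumes "z \<in> D"
  shows "spray_coeff H i z - 1 / (real CARD('n) + 1) * (\<Sum>m\<in>UNIV. partial_y m (spray_coeff H m) z) * snd z $ i =
    (\<Sum>m\<in>UNIV. (\<Sum>k\<in>UNIV. Q i m k (fst z) * snd z $ k) * snd z $ m) + 1 / 2 * (\<alpha> z * curl_vec i z)"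
proof -
  let ?c = "1 / (real CARD('n) + 1)" and ?T = "\<Sum>k\<in>UNIV. geo_trace k (fst z) * snd z $ k"
  have "(\<Sum>k\<in>UNIV. Q i m k (fst z) * snd z $ k) =
      (\<Sum>k\<in>UNIV. geo i m k (fst z) * snd z $ k) - ?c * (if i = m then ?T else 0)" for m
    by (simp add: Q_def left_diff_distrib sum_subtractf sum_divide_distrib)
  then have "(\<Sum>m\<in>UNIV. (\<Sum>k\<in>UNIV. Q i m k (fst z) * snd z $ k) * snd z $ m) = \<Gamma> i z - ?c * ?T * snd z $ i"
    by (simp add: \<Gamma>_def left_diff_distrib sum_subtractf if_distrib[of "\<lambda>x. x * _"] if_distrib[of "\<lambda>x. _ * x"] cong: if_cong)
  moreover have "?c * (?T + (real CARD('n) + 1) * P z) = ?c * ?T + P z"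
    by (simp add: field_simps)
  then have "?c * (?T + (real CARD('n) + 1) * P z) * snd z $ i = ?c * ?T * snd z $ i + P z * snd z $ i"
    by (simp only: distrib_right)
  ultimately show ?thesis
    unfolding spray_coeff_H[OF assms] divergence_spray[OF assms] G_def by linarith
qed

text \<open>The derivative of \<open>low\<^sub>l low\<^sub>k / \<alpha>\<^sup>3\<close>, the second term of \<open>hess\<close>, written as a product of the normalized covectors
\<open>low / \<alpha>\<close>, whose derivative is again \<open>hess\<close>.\<close>

definition "hess_quad l k j z = (hess l j z * (low k z / \<alpha> z) + low l z / \<alpha> z * hess k j z) * inverse (\<alpha> z)
  + low l z / \<alpha> z * (low k z / \<alpha> z) * (- low j z / \<alpha> z ^ 3)"

lemma has_partials_hess:
  assumes "z \<in> D"
  shows "\<exists>a. has_partials (hess l k) z a (\<lambda>j. \<gamma> (fst z) l k * (- low j z / \<alpha> z ^ 3) - hess_quad l k j z)"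
proof -
  have "(\<lambda>x. \<gamma> x l k) differentiable (at (fst z))" using assms by (auto intro: differentiable_metric_form)
  note x = has_partials_x[of "\<lambda>x. \<gamma> x l k" z, OF this]
  note i = has_partials_inverse_\<alpha>[OF assms]
  note n = has_partials_normal[OF assms]
  have eq: "hess l k = (\<lambda>z. \<gamma> (fst z) l k * inverse (\<alpha> z) + - 1 * (low l z / \<alpha> z * (low k z / \<alpha> z) * inverse (\<alpha> z)))"
    by (simp add: hess_def fun_eq_iff divide_inverse power3_eq_cube mult_ac)
  show ?thesis unfolding eq
    by (rule exI, rule has_partials_eq_rhs[OF has_partials_add[OF has_partials_mult[OF x i]
            has_partials_cmult[OF has_partials_mult[OF has_partials_mult[OF n n] i]]] refl])
      (simp add: hess_quad_def)
qed

text \<open>Leibniz rule for three derivatives of \<open>\<alpha> w\<^sup>i / 2\<close>, where \<open>w\<close> is linear in \<open>y\<close>: all three derivatives fall on \<open>\<alpha>\<close>,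
or two of them do and the third falls on \<open>w\<close>.\<close>

lemma douglas_tensor_H:
  assumes z: "z \<in> D"
  shows "douglas_tensor H i j k l z =
    1 / 2 * ((\<gamma> (fst z) l k * (- low j z / \<alpha> z ^ 3) - hess_quad l k j z) * curl_vec i z + hess l k z * curl_up i j (fst z)
      + hess l j z * curl_up i k (fst z) + hess k j z * curl_up i l (fst z))"
proof -
  have 1: "partial_y l (\<lambda>w. spray_coeff H i w - 1 / (real CARD('n) + 1) *
            (\<Sum>m\<in>UNIV. partial_y m (spray_coeff H m) w) * snd w $ i) z =
      (\<Sum>k\<in>UNIV. Q i l k (fst z) * snd z $ k) + (\<Sum>m\<in>UNIV. Q i m l (fst z) * snd z $ m)
        + 1 / 2 * (low l z / \<alpha> z * curl_vec i z + \<alpha> z * curl_up i l (fst z))"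
    if z: "z \<in> D" for z
  proof -
    have q: "Q i m k differentiable (at (fst z))" for m k using z by (auto intro: Q_differentiable)
    obtain a where w: "has_partials (curl_vec i) z a (\<lambda>k. curl_up i k (fst z))" using has_partials_curl_vec[OF z] by blast
    have "\<exists>a. has_partials (\<lambda>z. \<Sum>m\<in>UNIV. (\<Sum>k\<in>UNIV. Q i m k (fst z) * snd z $ k) * snd z $ m) z a
        (\<lambda>l. (\<Sum>k\<in>UNIV. Q i l k (fst z) * snd z $ k) + (\<Sum>m\<in>UNIV. Q i m l (fst z) * snd z $ m))"
      by (intro exI) (rule has_partials_contract, rule has_partials_linear_form, rule q)
    then obtain a' where q': "has_partials (\<lambda>z. \<Sum>m\<in>UNIV. (\<Sum>k\<in>UNIV. Q i m k (fst z) * snd z $ k) * snd z $ m) z a'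
        (\<lambda>l. (\<Sum>k\<in>UNIV. Q i l k (fst z) * snd z $ k) + (\<Sum>m\<in>UNIV. Q i m l (fst z) * snd z $ m))" ..
    have "partial_y l (\<lambda>w. spray_coeff H i w - 1 / (real CARD('n) + 1) *
            (\<Sum>m\<in>UNIV. partial_y m (spray_coeff H m) w) * snd w $ i) z =
        partial_y l (\<lambda>z. (\<Sum>m\<in>UNIV. (\<Sum>k\<in>UNIV. Q i m k (fst z) * snd z $ k) * snd z $ m) + 1 / 2 * (\<alpha> z * curl_vec i z)) z"
      by (rule partial_y_cong_open[OF open_D z douglas_argument])
    also note has_partials_imp_partial_y[OF has_partials_add[OF q'
          has_partials_cmult[OF has_partials_mult[OF has_partials_\<alpha>[OF z] w]]]]
    finally show ?thesis .
  qed
  have 2: "partial_y k (partial_y l (\<lambda>w. spray_coeff H i w - 1 / (real CARD('n) + 1) *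
            (\<Sum>m\<in>UNIV. partial_y m (spray_coeff H m) w) * snd w $ i)) z =
      Q i l k (fst z) + Q i k l (fst z)
        + 1 / 2 * ((hess l k z * curl_vec i z + low l z / \<alpha> z * curl_up i k (fst z)) + low k z / \<alpha> z * curl_up i l (fst z))"
    if z: "z \<in> D" for z
  proof -
    have q: "Q i m k differentiable (at (fst z))" for m k using z by (auto intro: Q_differentiable)
    have e: "curl_up i l differentiable (at (fst z))" using z by (auto intro: curl_up_differentiable)
    obtain a where w: "has_partials (curl_vec i) z a (\<lambda>k. curl_up i k (fst z))" using has_partials_curl_vec[OF z] by blast
    note p = has_partials_add[OF has_partials_add[OF has_partials_linear_form[where \<phi> = "Q i l", OF q]
          has_partials_linear_form[where \<phi> = "\<lambda>m. Q i m l", OF q]]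
        has_partials_cmult[OF has_partials_add[OF has_partials_mult[OF has_partials_normal[OF z] w]
          has_partials_mult[OF has_partials_\<alpha>[OF z] has_partials_x[OF e]]], where r = "1 / 2"]]
    show ?thesis
      by (rule trans[OF partial_y_cong_open[OF open_D z 1] trans[OF has_partials_imp_partial_y[OF p]]])
        (simp_all add: add.assoc)
  qed
  obtain a where w: "has_partials (curl_vec i) z a (\<lambda>k. curl_up i k (fst z))" using has_partials_curl_vec[OF z] by blast
  obtain a' where hess: "has_partials (hess l k) z a' (\<lambda>j. \<gamma> (fst z) l k * (- low j z / \<alpha> z ^ 3) - hess_quad l k j z)"
    using has_partials_hess[OF z] by blast
  have q: "Q i m k differentiable (at (fst z))" for m k using z by (auto intro: Q_differentiable)
  have e: "curl_up i l differentiable (at (fst z))" for l using z by (auto intro: curl_up_differentiable)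
  note p = has_partials_add[OF has_partials_add[OF has_partials_x[OF q[of l k]] has_partials_x[OF q[of k l]]]
      has_partials_cmult[OF has_partials_add[OF has_partials_add[OF has_partials_mult[OF hess w]
        has_partials_mult[OF has_partials_normal[OF z] has_partials_x[OF e]]]
        has_partials_mult[OF has_partials_normal[OF z] has_partials_x[OF e]]], where r = "1 / 2"]]
  show ?thesis
    unfolding douglas_tensor_def
    by (rule trans[OF partial_y_cong_open[OF open_D z 2] trans[OF has_partials_imp_partial_y[OF p]]])
      simp_all
qed

lemma curl_up_zero_iff:
  assumes "x \<in> U"
  shows "(\<forall>i k. curl_up i k x = 0) \<longleftrightarrow> (\<forall>k l. curl k l x = 0)"
proof
  assume *: "\<forall>i k. curl_up i k x = 0"
  have "(\<Sum>i\<in>UNIV. \<gamma> x l i * curl_up i k x) = curl k l x" for k l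
    unfolding curl_up_def by (rule lower_raise[OF assms, of l "\<lambda>l. curl k l x"])
  moreover have "(\<Sum>i\<in>UNIV. \<gamma> x l i * curl_up i k x) = 0" for k l
    using * by simp
  ultimately show "\<forall>k l. curl k l x = 0" by metis
qed (simp add: curl_up_def)

text \<open>The conclusion says that \<open>w\<^sup>i\<close> vanishes at \<open>v\<close>. If \<open>y\<close> is orthogonal to \<open>v\<close>, then along the line
\<open>y + t v\<close> the function \<open>\<alpha>\<close> is even in \<open>t\<close>, so that its third derivative at \<open>t = 0\<close> vanishes, while its
second derivative is \<open>\<parallel>v\<parallel>\<^sup>2/\<alpha>\<close>. In the contraction of the Douglas tensor with \<open>v, v, v\<close>
only \<open>3 \<parallel>v\<parallel>\<^sup>2 w\<^sup>i(v) / (2\<alpha>)\<close> is left. The three contractions are carried out one index at a time.\<close>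

lemma douglas_zero_imp_curl_vec_zero:
  assumes D0: "\<And>j k l. douglas_tensor H i j k l z = 0"
    and z: "z \<in> D" and v: "v \<noteq> 0" "(\<Sum>k\<in>UNIV. low k z * v $ k) = 0"
  shows "(\<Sum>k\<in>UNIV. curl_up i k (fst z) * v $ k) = 0"
proof -
  let ?a = "\<alpha> z" and ?E = "\<lambda>k. curl_up i k (fst z)"
  define vl where "vl l = (\<Sum>k\<in>UNIV. \<gamma> (fst z) l k * v $ k)" for l
  define V where "V = (\<Sum>l\<in>UNIV. vl l * v $ l)"
  define Ev where "Ev = (\<Sum>k\<in>UNIV. ?E k * v $ k)"
  have a: "?a > 0" using \<alpha>_pos[OF z] .
  have V: "V > 0" using \<gamma>_pos[of "fst z" v] z v(1) by (auto simp: V_def vl_def)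
  have lv: "(\<Sum>k\<in>UNIV. c * (low k z * v $ k)) = 0" for c
    using v(2) by (simp flip: sum_distrib_left)
  have hess_v: "(\<Sum>k\<in>UNIV. hess l k z * v $ k) = vl l / ?a" for l
  proof -
    have "(\<Sum>k\<in>UNIV. hess l k z * v $ k) = (\<Sum>k\<in>UNIV. \<gamma> (fst z) l k * v $ k) / ?a - low l z * (\<Sum>k\<in>UNIV. low k z * v $ k) / ?a ^ 3"
      unfolding sum_divide_distrib sum_distrib_left sum_subtractf[symmetric]
      by (simp add: hess_def left_diff_distrib mult.assoc)
    then show ?thesis using v(2) by (simp add: vl_def)
  qed
  have 0: "(\<gamma> (fst z) l k * (- low j z / ?a ^ 3) - hess_quad l k j z) * curl_vec i z + hess l k z * ?E j
      + hess l j z * ?E k + hess k j z * ?E l = 0" for j k l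
    using D0[of j k l] unfolding douglas_tensor_H[OF z] mult_eq_0_iff by simp
  have 1: "- ((vl l / ?a * (low k z / ?a) + low l z / ?a * (vl k / ?a)) / ?a) * curl_vec i z + hess l k z * Ev
      + vl l / ?a * ?E k + vl k / ?a * ?E l = 0" for k l
  proof -
    have "(\<Sum>j\<in>UNIV. hess_quad l k j z * v $ j) = ((\<Sum>j\<in>UNIV. hess l j z * v $ j) * (low k z / ?a)
        + low l z / ?a * (\<Sum>j\<in>UNIV. hess k j z * v $ j)) / ?a
        + low l z / ?a * (low k z / ?a) * (- (\<Sum>j\<in>UNIV. low j z * v $ j) / ?a ^ 3)"
      unfolding sum_distrib_left sum_distrib_right sum_divide_distrib sum_negf[symmetric] sum.distrib[symmetric]
      by (intro sum.cong refl) (simp add: hess_quad_def inverse_eq_divide add_divide_distrib diff_divide_distrib distrib_left distrib_right right_diff_distrib left_diff_distrib mult_ac)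
    then have quad_v: "(\<Sum>j\<in>UNIV. hess_quad l k j z * v $ j) = (vl l / ?a * (low k z / ?a) + low l z / ?a * (vl k / ?a)) / ?a"
      unfolding hess_v v(2) by simp
    have "0 = (\<Sum>j\<in>UNIV. ((\<gamma> (fst z) l k * (- low j z / ?a ^ 3) - hess_quad l k j z) * curl_vec i z + hess l k z * ?E j
      + hess l j z * ?E k + hess k j z * ?E l) * v $ j)"
      unfolding 0 by simp
    also have "\<dots> = (\<gamma> (fst z) l k * (- (\<Sum>j\<in>UNIV. low j z * v $ j) / ?a ^ 3) - (\<Sum>j\<in>UNIV. hess_quad l k j z * v $ j)) * curl_vec i z + hess l k z * Ev
      + (\<Sum>j\<in>UNIV. hess l j z * v $ j) * ?E k + (\<Sum>j\<in>UNIV. hess k j z * v $ j) * ?E l"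
      unfolding Ev_def sum_distrib_left sum_distrib_right sum_divide_distrib sum_negf[symmetric] sum.distrib[symmetric]
        sum_subtractf[symmetric]
      by (intro sum.cong refl) (simp add: algebra_simps)
    finally show ?thesis unfolding quad_v hess_v v(2) by simp
  qed
  have 2: "- (low l z / ?a * (V / ?a) / ?a) * curl_vec i z + 2 * (vl l / ?a * Ev) + V / ?a * ?E l = 0" for l
  proof -
    have "0 = (\<Sum>k\<in>UNIV. (- ((vl l / ?a * (low k z / ?a) + low l z / ?a * (vl k / ?a)) / ?a) * curl_vec i z + hess l k z * Ev
      + vl l / ?a * ?E k + vl k / ?a * ?E l) * v $ k)"
      unfolding 1 by simp
    also have "\<dots> = - ((vl l / ?a * ((\<Sum>k\<in>UNIV. low k z * v $ k) / ?a) + low l z / ?a * ((\<Sum>k\<in>UNIV. vl k * v $ k) / ?a)) / ?a) * curl_vec i z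
      + (\<Sum>k\<in>UNIV. hess l k z * v $ k) * Ev + vl l / ?a * (\<Sum>k\<in>UNIV. ?E k * v $ k) + (\<Sum>k\<in>UNIV. vl k * v $ k) / ?a * ?E l"
      unfolding sum_distrib_left sum_distrib_right sum_divide_distrib sum_negf[symmetric] sum.distrib[symmetric]
      by (intro sum.cong refl) (simp add: algebra_simps)
    finally show ?thesis unfolding hess_v v(2) V_def[symmetric] Ev_def[symmetric] by (simp add: mult.commute)
  qed
  have "0 = (\<Sum>l\<in>UNIV. (- (low l z / ?a * (V / ?a) / ?a) * curl_vec i z + 2 * (vl l / ?a * Ev) + V / ?a * ?E l) * v $ l)"
    unfolding 2 by simp
  also have "\<dots> = - ((\<Sum>l\<in>UNIV. low l z * v $ l) / ?a * (V / ?a) / ?a) * curl_vec i z + 2 * ((\<Sum>l\<in>UNIV. vl l * v $ l) / ?a * Ev) + V / ?a * (\<Sum>l\<in>UNIV. ?E l * v $ l)"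
    unfolding sum_distrib_left sum_distrib_right sum_divide_distrib sum_negf[symmetric] sum.distrib[symmetric]
    by (intro sum.cong refl) (simp add: algebra_simps)
  also have "\<dots> = 3 * (V / ?a * Ev)"
    unfolding v(2) V_def[symmetric] Ev_def[symmetric] by simp
  finally show ?thesis using V a by (simp add: Ev_def)
qed

theorem douglas_iff_closed:
  "(\<forall>z\<in>D. \<forall>i j k l. douglas_tensor H i j k l z = 0) \<longleftrightarrow> (\<forall>x\<in>U. \<forall>k l. curl k l x = 0)"
proof
  assume "\<forall>x\<in>U. \<forall>k l. curl k l x = 0"
  then have "curl_up i k x = 0" if "x \<in> U" for i k x
    using curl_up_zero_iff[OF that] that by blast
  then show "\<forall>z\<in>D. \<forall>i j k l. douglas_tensor H i j k l z = 0"
    by (auto simp: douglas_tensor_H curl_vec_def)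
next
  assume D0: "\<forall>z\<in>D. \<forall>i j k l. douglas_tensor H i j k l z = 0"
  show "\<forall>x\<in>U. \<forall>k l. curl k l x = 0"
  proof (cases "CARD('n) = 1")
    case True
    \<comment> \<open>A skew form in dimension 1 vanishes.\<close>
    then have "k = l" for k l :: 'n by (metis (full_types) UNIV_I card_1_singletonE singletonD)
    then show ?thesis by (metis curl_def diff_self)
  next
    case False
    then have dim: "2 \<le> DIM(real ^ 'n)"
      using zero_less_card_finite[where 'a = 'n] by (simp del: zero_less_card_finite)
    show ?thesis
    proof
      fix x assume x: "x \<in> U"
      have "curl_up i k x = 0" for i k
      proof -
        let ?v = "axis k 1 :: real ^ 'n"
        \<comment> \<open>This \<open>y\<close> is \<open>\<gamma>\<close>-orthogonal to the coordinate vector \<open>v\<close>; it exists since the dimension is at least 2.\<close>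
        obtain y :: "real ^ 'n" where y: "y \<noteq> 0" "orthogonal (\<chi> m. \<Sum>l\<in>UNIV. \<gamma> x m l * ?v $ l) y"
          using orthogonal_to_vector_exists[OF dim] by blast
        have z: "(x, y) \<in> D" using x y by simp
        have "(\<Sum>k\<in>UNIV. low k (x, y) * ?v $ k) = 0"
          using y(2) unfolding low_contract[OF z] by (simp add: orthogonal_def inner_vec_def)
        then show ?thesis
          using douglas_zero_imp_curl_vec_zero[of i "(x, y)" ?v] D0 z by (simp add: sum_axis)
      qed
      then show "\<forall>k l. curl k l x = 0" using curl_up_zero_iff[OF x] by blast
    qed
  qed
qed

end

section \<open>Charts, tangent vectors and vector fields\<close>

locale smooth_atlas =
  fixes A :: "('m::{t2_space, second_countable_topology}, 'n::finite) atlas"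
  assumes smooth_manifold: "smooth_manifold A"
begin

lemma chart_cover: "\<exists>c. c \<in> charts_at A p"
proof -
  have "p \<in> (\<Union>c\<in>A. fst c)" using smooth_manifold unfolding smooth_manifold_def by blast
  then show ?thesis unfolding charts_at_def by blast
qed

lemma chart_homeomorphism:
  assumes "c \<in> A"
  shows "open (fst c)" "open (chart_image c)" "homeomorphism (fst c) (chart_image c) (snd c) (chart_inv c)"
  using smooth_manifold assms unfolding smooth_manifold_def by blast+

lemma chart_inv_snd: "c \<in> A \<Longrightarrow> p \<in> fst c \<Longrightarrow> chart_inv c (snd c p) = p"
  using chart_homeomorphism(3) unfolding homeomorphism_def by blast

lemma snd_chart_inv: "c \<in> A \<Longrightarrow> x \<in> chart_image c \<Longrightarrow> snd c (chart_inv c x) = x"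
  using chart_homeomorphism(3) unfolding homeomorphism_def by blast

lemma chart_inv_mem: "c \<in> A \<Longrightarrow> x \<in> chart_image c \<Longrightarrow> chart_inv c x \<in> fst c"
  using chart_homeomorphism(3) unfolding homeomorphism_def by blast

lemma snd_mem: "p \<in> fst c \<Longrightarrow> snd c p \<in> chart_image c"
  by (auto simp: chart_image_def)

lemma chart_inv_charts_at: "c \<in> A \<Longrightarrow> x \<in> chart_image c \<Longrightarrow> c \<in> charts_at A (chart_inv c x)"
  by (simp add: charts_at_def chart_inv_mem)

lemma open_chart_subset:
  assumes c: "c \<in> A" and V: "open V"
  shows "open (snd c ` (fst c \<inter> V))"
proof -
  have "snd c ` (fst c \<inter> V) = chart_image c \<inter> chart_inv c -` V"
    using chart_inv_snd[OF c] snd_chart_inv[OF c] chart_inv_mem[OF c] by (force simp: chart_image_def)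
  moreover have "continuous_on (chart_image c) (chart_inv c)"
    using chart_homeomorphism(3)[OF c] by (simp add: homeomorphism_def)
  ultimately show ?thesis
    using continuous_open_preimage chart_homeomorphism(2)[OF c] V by metis
qed

lemma smooth_transition:
  "c \<in> A \<Longrightarrow> c' \<in> A \<Longrightarrow> smooth_on (snd c ` (fst c \<inter> fst c')) (snd c' \<circ> chart_inv c)"
  using smooth_manifold unfolding smooth_manifold_def by blast

lemma differentiable_transition:
  "c \<in> charts_at A p \<Longrightarrow> c' \<in> charts_at A p \<Longrightarrow> (snd c' \<circ> chart_inv c) differentiable (at (snd c p))"
  by (rule smooth_on_differentiable[OF smooth_transition]) (auto simp: charts_at_def)

lemma linear_coord_change: "c \<in> charts_at A p \<Longrightarrow> c' \<in> charts_at A p \<Longrightarrow> linear (coord_change c c' p)"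
  unfolding coord_change_def by (rule linear_frechet_derivative[OF differentiable_transition])

text \<open>The chain rule for a change of charts. It is stated for maps into any Euclidean space, because it is applied to
coordinate maps (for the cocycle property), to functions (for \<open>vf_apply\<close>) and to components of
vector fields (for the Lie bracket).\<close>

lemma chart_change_derivative:
  fixes u :: "'m \<Rightarrow> 'b::euclidean_space"
  assumes c: "c \<in> charts_at A p" "c' \<in> charts_at A p"
    and u: "((u \<circ> chart_inv c') has_derivative u') (at (snd c' p))"
  shows "((u \<circ> chart_inv c) has_derivative (\<lambda>v. u' (coord_change c c' p v))) (at (snd c p))"
proof -
  have A: "c \<in> A" "c' \<in> A" "p \<in> fst c" "p \<in> fst c'" using c by (auto simp: charts_at_def)
  let ?\<phi> = "snd c' \<circ> chart_inv c"
  have "(?\<phi> has_derivative coord_change c c' p) (at (snd c p))"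
    unfolding coord_change_def using differentiable_transition[OF c] by (simp add: frechet_derivative_works)
  moreover have "?\<phi> (snd c p) = snd c' p" using A by (simp add: chart_inv_snd)
  ultimately have "((u \<circ> chart_inv c') \<circ> ?\<phi> has_derivative u' \<circ> coord_change c c' p) (at (snd c p))"
    using u by (intro diff_chain_at) simp_all
  then have "((u \<circ> chart_inv c') \<circ> ?\<phi> has_derivative (\<lambda>v. u' (coord_change c c' p v))) (at (snd c p))"
    by (simp only: comp_def)
  then show ?thesis
  proof (rule has_derivative_transform_within_open)
    show "open (snd c ` (fst c \<inter> fst c'))" using A by (intro open_chart_subset chart_homeomorphism)
    show "snd c p \<in> snd c ` (fst c \<inter> fst c')" using A by auto
    show "((u \<circ> chart_inv c') \<circ> ?\<phi>) x = (u \<circ> chart_inv c) x" if "x \<in> snd c ` (fst c \<inter> fst c')" for x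
      using that A by (auto simp: chart_inv_snd)
  qed
qed

lemma coord_change_cocycle:
  assumes "c \<in> charts_at A p" "c' \<in> charts_at A p" "c'' \<in> charts_at A p"
  shows "coord_change c c'' p v = coord_change c' c'' p (coord_change c c' p v)"
proof -
  have "((snd c'' \<circ> chart_inv c') has_derivative coord_change c' c'' p) (at (snd c' p))"
    unfolding coord_change_def using differentiable_transition[OF assms(2,3)] by (simp add: frechet_derivative_works)
  from frechet_derivative_at[OF chart_change_derivative[OF assms(1,2) this]]
  show ?thesis unfolding coord_change_def[of c c''] by metis
qed

lemma coord_change_self:
  assumes "c \<in> charts_at A p"
  shows "coord_change c c p v = v"
proof -
  have A: "c \<in> A" "p \<in> fst c" using assms by (auto simp: charts_at_def)
  have "((snd c \<circ> chart_inv c) has_derivative (\<lambda>v. v)) (at (snd c p))"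
    by (rule has_derivative_transform_within_open[OF has_derivative_ident chart_homeomorphism(2)[OF A(1)] snd_mem[OF A(2)]])
      (simp add: snd_chart_inv A)
  from frechet_derivative_at[OF this] show ?thesis unfolding coord_change_def by metis
qed

lemma coord_vec_component: "c \<in> charts_at A p \<Longrightarrow> coord_vec A c p y c = y"
  by (simp add: coord_vec_def coord_change_self)

lemma coord_vec_tangent:
  assumes "c \<in> charts_at A p"
  shows "coord_vec A c p y \<in> tangent_space A p"
  unfolding tangent_space_def coord_vec_def
proof (intro CollectI conjI ballI allI impI, goal_cases)
  case (1 c' c'')
  then show ?case using coord_change_cocycle[OF assms 1, of y] by simp
qed simp

lemma tangent_eq_coord_vec:
  assumes "c \<in> charts_at A p" "v \<in> tangent_space A p"
  shows "coord_vec A c p (v c) = v"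
proof
  fix c'
  have "coord_change c c' p (v c) = v c'" if "c' \<in> charts_at A p"
    using assms that unfolding tangent_space_def by fastforce
  moreover have "v c' = 0" if "c' \<notin> charts_at A p"
    using assms that unfolding tangent_space_def by blast
  ultimately show "coord_vec A c p (v c) c' = v c'" by (simp add: coord_vec_def)
qed

lemma coord_vec_lincomb:
  assumes "c \<in> charts_at A p"
  shows "coord_vec A c p (r *\<^sub>R y + s *\<^sub>R z) = (\<lambda>c'. r *\<^sub>R coord_vec A c p y c' + s *\<^sub>R coord_vec A c p z c')"
  by (rule ext) (simp add: coord_vec_def linear_add[OF linear_coord_change[OF assms]] linear_scale[OF linear_coord_change[OF assms]])

lemma linear_on_tangent_coords:
  assumes c: "c \<in> charts_at A p" and l: "linear_on_tangent A p l"
  shows "l (coord_vec A c p y) = (\<Sum>j\<in>UNIV. l (coord_vec A c p (axis j 1)) * y $ j)"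
proof -
  have *: "l (coord_vec A c p (r *\<^sub>R y + s *\<^sub>R z)) = r * l (coord_vec A c p y) + s * l (coord_vec A c p z)" for r s y z
    using l coord_vec_tangent[OF c] unfolding coord_vec_lincomb[OF c] linear_on_tangent_def by blast
  have "linear (\<lambda>y. l (coord_vec A c p y))"
    using *[of 1 _ 1] *[of _ _ 0] by (intro linearI) auto
  then show ?thesis by (rule linear_axis_expansion)
qed

lemma vector_field_transform:
  assumes "vector_field A Y" "c \<in> charts_at A p" "c' \<in> charts_at A p"
  shows "Y p c' = coord_change c c' p (Y p c)"
  using assms unfolding vector_field_def tangent_space_def by blast

lemma vector_field_differentiable:
  assumes "vector_field A Y" "c \<in> charts_at A p"
  shows "(\<lambda>x. Y (chart_inv c x) c) differentiable (at (snd c p))"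
proof (rule smooth_on_differentiable)
  show "smooth_on (chart_image c) (\<lambda>x. Y (chart_inv c x) c)" "snd c p \<in> chart_image c"
    using assms by (simp_all add: vector_field_def charts_at_def snd_mem)
qed

text \<open>Differentiating the transformation law \<open>Z' = D\<phi> Z\<close> in the direction of \<open>Y\<close>. The second derivative
of \<open>\<phi>\<close> measures how far \<open>Y\<^sup>j \<partial>\<^sub>j Z\<^sup>i\<close> is from being a tangent vector; it is symmetric in \<open>Y\<close> and \<open>Z\<close> and cancels
in the bracket.\<close>

lemma lie_bracket_derivative:
  assumes Y: "vector_field A Y" and Z: "vector_field A Z" and c: "c \<in> charts_at A p" "c' \<in> charts_at A p"
  shows "frechet_derivative (\<lambda>x. Z (chart_inv c' x) c') (at (snd c' p)) (Y p c') =
    coord_change c c' p (frechet_derivative (\<lambda>x. Z (chart_inv c x) c) (at (snd c p)) (Y p c))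
    + frechet_derivative (\<lambda>y. frechet_derivative (snd c' \<circ> chart_inv c) (at y) (Z p c)) (at (snd c p)) (Y p c)"
proof -
  have A: "c \<in> A" "c' \<in> A" "p \<in> fst c" "p \<in> fst c'" using c by (auto simp: charts_at_def)
  let ?S = "snd c ` (fst c \<inter> fst c')" and ?\<phi> = "snd c' \<circ> chart_inv c" and ?x = "snd c p"
  let ?Z = "\<lambda>c x. Z (chart_inv c x) c"
  have S: "open ?S" "?x \<in> ?S" using A by (auto intro!: open_chart_subset chart_homeomorphism)
  have \<phi>: "Ck_on 2 ?S ?\<phi>" using smooth_transition[OF A(1,2)] by (simp add: smooth_on_def)
  have "(((\<lambda>q. Z q c') \<circ> chart_inv c') has_derivative frechet_derivative (?Z c') (at (snd c' p))) (at (snd c' p))"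
    using vector_field_differentiable[OF Z c(2)] by (simp add: frechet_derivative_works comp_def)
  from chart_change_derivative[OF c this]
  have 1: "((\<lambda>x. Z (chart_inv c x) c') has_derivative
      (\<lambda>v. frechet_derivative (?Z c') (at (snd c' p)) (coord_change c c' p v))) (at ?x)"
    by (simp add: comp_def)
  have d: "(?Z c has_derivative frechet_derivative (?Z c) (at ?x)) (at ?x)"
    using vector_field_differentiable[OF Z c(1)] by (simp add: frechet_derivative_works)
  have Zp: "?Z c ?x = Z p c" using A by (simp add: chart_inv_snd)
  have eq: "frechet_derivative ?\<phi> (at x) (?Z c x) = Z (chart_inv c x) c'" if "x \<in> ?S" for x
  proof -
    have q: "c \<in> charts_at A (chart_inv c x)" "c' \<in> charts_at A (chart_inv c x)" "snd c (chart_inv c x) = x"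
      using that A by (auto simp: charts_at_def chart_inv_snd)
    then show ?thesis using vector_field_transform[OF Z q(1,2)] by (simp add: coord_change_def)
  qed
  have "((\<lambda>x. Z (chart_inv c x) c') has_derivative
    (\<lambda>u. frechet_derivative ?\<phi> (at ?x) (frechet_derivative (?Z c) (at ?x) u)
      + frechet_derivative (\<lambda>y. frechet_derivative ?\<phi> (at y) (?Z c ?x)) (at ?x) u)) (at ?x)"
    by (rule has_derivative_transform_within_open[OF has_derivative_applied_derivative[OF S \<phi> d] S eq])
  from fun_cong[OF has_derivative_unique[OF 1 this], of "Y p c"]
  show ?thesis unfolding Zp vector_field_transform[OF Y c] coord_change_def .
qed

text \<open>A 1-form is linear on tangent spaces only, so its value on the Lie bracket can be computed in coordinates only
once the bracket is known to be a tangent vector.\<close>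

lemma lie_bracket_tangent:
  assumes Y: "vector_field A Y" and Z: "vector_field A Z"
  shows "lie_bracket A Y Z p \<in> tangent_space A p"
  unfolding tangent_space_def
proof (intro CollectI conjI ballI allI impI)
  fix c c' assume c: "c \<in> charts_at A p" "c' \<in> charts_at A p"
  have A: "c \<in> A" "c' \<in> A" "p \<in> fst c" "p \<in> fst c'" using c by (auto simp: charts_at_def)
  let ?S = "snd c ` (fst c \<inter> fst c')"
  have S: "open ?S" "snd c p \<in> ?S" using A by (auto intro!: open_chart_subset chart_homeomorphism)
  have \<phi>: "Ck_on 2 ?S (snd c' \<circ> chart_inv c)" using smooth_transition[OF A(1,2)] by (simp add: smooth_on_def)
  show "lie_bracket A Y Z p c' = coord_change c c' p (lie_bracket A Y Z p c)"
    using c unfolding lie_bracket_def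
    by (simp add: lie_bracket_derivative[OF Y Z c] lie_bracket_derivative[OF Z Y c]
        linear_diff[OF linear_coord_change[OF c]]
        symmetric_second_derivative_euclidean[OF S \<phi>, of "Z p c" "Y p c"])
qed (simp add: lie_bracket_def)

lemma vf_apply_chart:
  assumes Y: "vector_field A Y" and c: "c \<in> charts_at A p"
    and h: "\<And>c. c \<in> charts_at A p \<Longrightarrow> (h \<circ> chart_inv c) differentiable (at (snd c p))"
  shows "vf_apply A Y h p = frechet_derivative (h \<circ> chart_inv c) (at (snd c p)) (Y p c)"
proof -
  define c' where "c' = (SOME c. c \<in> charts_at A p)"
  have c': "c' \<in> charts_at A p" unfolding c'_def using chart_cover by (rule someI_ex)
  have "frechet_derivative (h \<circ> chart_inv c) (at (snd c p)) =
      (\<lambda>v. frechet_derivative (h \<circ> chart_inv c') (at (snd c' p)) (coord_change c c' p v))"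
    using frechet_derivative_at[OF chart_change_derivative[OF c c' h[OF c', unfolded frechet_derivative_works]], symmetric] .
  then show ?thesis
    unfolding vf_apply_def c'_def[symmetric] Let_def by (simp add: vector_field_transform[OF Y c c'])
qed

text \<open>A constant field in the chart \<open>c\<close> is cut off by a bump function and extended by \<open>0\<close>. The
support lies in the preimage \<open>K\<close> of a compact ball. As \<open>K\<close> is closed, by compactness and the Hausdorff
property, in every other chart the field is smooth on the open sets that correspond to the domain of \<open>c\<close> and
to the complement of \<open>K\<close>.\<close>

lemma vector_field_exists:
  assumes c: "c \<in> charts_at A p"
  shows "\<exists>Y. vector_field A Y \<and> Y p c = e"
proof -
  have A: "c \<in> A" "p \<in> fst c" using c by (auto simp: charts_at_def)
  obtain r where r: "r > 0" "cball (snd c p) r \<subseteq> chart_image c"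
    using open_contains_cball chart_homeomorphism(2)[OF A(1)] snd_mem[OF A(2)] by metis
  obtain \<rho> :: "real ^ 'n \<Rightarrow> real" where \<rho>: "smooth_on UNIV \<rho>" "\<rho> (snd c p) \<noteq> 0" "\<And>x. x \<notin> cball (snd c p) r \<Longrightarrow> \<rho> x = 0"
    using bump_function_exists[OF r(1)] by metis
  \<comment> \<open>The bump function need not be \<open>1\<close> at \<open>p\<close>, which is compensated here.\<close>
  define e' where "e' = inverse (\<rho> (snd c p)) *\<^sub>R e"
  define Y where "Y q = (if q \<in> fst c then coord_vec A c q (\<rho> (snd c q) *\<^sub>R e') else (\<lambda>_. 0))" for q
  define K where "K = chart_inv c ` cball (snd c p) r"
  have "continuous_on (cball (snd c p) r) (chart_inv c)"
    using chart_homeomorphism(3)[OF A(1)] r(2) continuous_on_subset by (auto simp: homeomorphism_def)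
  then have K: "closed K" unfolding K_def by (intro compact_imp_closed compact_continuous_image compact_cball)
  have "Y p c = e"
    using A \<rho>(2) coord_vec_component[OF c] by (simp add: Y_def e'_def)
  moreover have "vector_field A Y"
    unfolding vector_field_def
  proof (intro conjI allI ballI)
    fix q
    show "Y q \<in> tangent_space A q"
    proof (cases "q \<in> fst c")
      case True
      then show ?thesis using A by (auto simp: Y_def charts_at_def intro!: coord_vec_tangent)
    next
      case False
      then show ?thesis by (auto simp: Y_def tangent_space_def linear_0[OF linear_coord_change])
    qed
  next
    fix c' assume c': "c' \<in> A"
    let ?S1 = "snd c' ` (fst c' \<inter> fst c)" and ?S2 = "snd c' ` (fst c' \<inter> - K)"
    let ?\<phi> = "snd c \<circ> chart_inv c'" and ?\<psi> = "snd c' \<circ> chart_inv c"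
    have S1: "open ?S1" by (intro open_chart_subset c' chart_homeomorphism A)
    have S2: "open ?S2" using K by (intro open_chart_subset c') auto
    have "K \<subseteq> fst c" using r(2) chart_inv_mem[OF A(1)] by (auto simp: K_def)
    then have un: "chart_image c' = ?S1 \<union> ?S2" by (auto simp: chart_image_def)
    have "Ck_on k ?S1 (\<lambda>x. Y (chart_inv c' x) c')" for k
    proof (rule Ck_on_cong[OF S1])
      have \<phi>: "Ck_on k ?S1 ?\<phi>" using smooth_transition[OF c' A(1)] by (simp add: smooth_on_def)
      have "Ck_on (Suc k) (snd c ` (fst c \<inter> fst c')) ?\<psi>"
        using smooth_transition[OF A(1) c'] unfolding smooth_on_def by blast
      then have "Ck_on k (snd c ` (fst c \<inter> fst c')) (\<lambda>x. frechet_derivative ?\<psi> (at x) e')" by simp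
      then have "Ck_on k ?S1 (\<lambda>x. frechet_derivative ?\<psi> (at (?\<phi> x)) e')"
        by (rule Ck_on_compose[OF S1 _ \<phi>]) (use c' in \<open>auto simp: chart_inv_snd\<close>)
      moreover have "Ck_on k ?S1 (\<lambda>x. \<rho> (?\<phi> x))"
        by (rule Ck_on_compose[OF S1 _ \<phi>]) (use \<rho>(1) in \<open>auto simp: smooth_on_def\<close>)
      ultimately show "Ck_on k ?S1 (\<lambda>x. \<rho> (?\<phi> x) *\<^sub>R frechet_derivative ?\<psi> (at (?\<phi> x)) e')"
        by (intro Ck_on_scaleR[OF S1])
      fix x assume "x \<in> ?S1"
      then obtain q where q: "q \<in> fst c'" "q \<in> fst c" "x = snd c' q" by auto
      then have "c \<in> charts_at A q" "c' \<in> charts_at A q" using A c' by (auto simp: charts_at_def)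
      then show "\<rho> (?\<phi> x) *\<^sub>R frechet_derivative ?\<psi> (at (?\<phi> x)) e' = Y (chart_inv c' x) c'"
        using q c' linear_scale[OF linear_coord_change]
        by (simp add: Y_def chart_inv_snd coord_vec_def) (simp add: coord_change_def)
    qed
    moreover have "Ck_on k ?S2 (\<lambda>x. Y (chart_inv c' x) c')" for k
    proof (rule Ck_on_cong[OF S2 Ck_on_const])
      fix x assume "x \<in> ?S2"
      then obtain q where q: "q \<in> fst c'" "q \<notin> K" "x = snd c' q" by auto
      show "0 = Y (chart_inv c' x) c'"
      proof (cases "q \<in> fst c")
        case True
        then have "snd c q \<notin> cball (snd c p) r"
          using q(2) chart_inv_snd[OF A(1) True] unfolding K_def by (metis imageI)
        moreover have "c \<in> charts_at A q" "c' \<in> charts_at A q" using A c' True q by (auto simp: charts_at_def)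
        ultimately show ?thesis
          using q c' True \<rho>(3) linear_0[OF linear_coord_change] by (simp add: Y_def chart_inv_snd coord_vec_def)
      next
        case False
        then show ?thesis using q c' by (simp add: Y_def chart_inv_snd)
      qed
    qed
    ultimately show "smooth_on (chart_image c') (\<lambda>x. Y (chart_inv c' x) c')"
      unfolding smooth_on_def un by (auto intro!: Ck_on_Un[OF S1 S2])
  qed
  ultimately show ?thesis by blast
qed

end

section \<open>The conformally changed Randers metric\<close>

locale conformal_randers = smooth_atlas A
  for A :: "('m::{t2_space, second_countable_topology}, 'n::finite) atlas" +
  fixes g :: "'m \<Rightarrow> ('m, 'n) tvec \<Rightarrow> ('m, 'n) tvec \<Rightarrow> real"
    and X :: "'m \<Rightarrow> ('m, 'n) tvec" and F :: "'m \<Rightarrow> ('m, 'n) tvec \<Rightarrow> real" and f :: "'m \<Rightarrow> real"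
  assumes randers: "randers_metric A g (flat g X) F" and f: "smooth_function A f"
begin

text \<open>Components in the chart \<open>c\<close> of the given data and of the conformally changed ones.\<close>

definition "\<beta>_coord c x j = flat g X (chart_inv c x) (coord_vec A c (chart_inv c x) (axis j 1))"
definition "g_coord c x i j = g (chart_inv c x) (coord_vec A c (chart_inv c x) (axis i 1)) (coord_vec A c (chart_inv c x) (axis j 1))"
definition "factor c x = exp ((f \<circ> chart_inv c) x)"
definition "\<beta>_conf c x j = factor c x * \<beta>_coord c x j"
definition "g_conf c x i j = (factor c x)\<^sup>2 * g_coord c x i j"
definition "F_conf p v = exp (f p) * F p v"

lemma finsler: "finsler_metric A F" and riemannian: "riemannian_metric A g"
  and one_form: "one_form A (flat g X)"
  and F_eq: "v \<in> tangent_space A p \<Longrightarrow> F p v = sqrt (g p v v) + flat g X p v"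
  using randers unfolding randers_metric_def by blast+

lemma flat_coords:
  assumes "c \<in> charts_at A p"
  shows "flat g X p (coord_vec A c p y) = (\<Sum>j\<in>UNIV. flat g X p (coord_vec A c p (axis j 1)) * y $ j)"
  using one_form unfolding one_form_def by (intro linear_on_tangent_coords[OF assms]) blast

lemma g_coords:
  assumes c: "c \<in> charts_at A p"
  shows "g p (coord_vec A c p y) (coord_vec A c p y) =
    (\<Sum>l\<in>UNIV. (\<Sum>m\<in>UNIV. g p (coord_vec A c p (axis l 1)) (coord_vec A c p (axis m 1)) * y $ m) * y $ l)"
proof -
  have lin: "g p u (coord_vec A c p y) = (\<Sum>j\<in>UNIV. g p u (coord_vec A c p (axis j 1)) * y $ j)"
    if "u \<in> tangent_space A p" for u
    using riemannian that unfolding riemannian_metric_def by (intro linear_on_tangent_coords[OF c]) blast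
  have sym: "g p u v = g p v u" if "u \<in> tangent_space A p" "v \<in> tangent_space A p" for u v
    using riemannian that unfolding riemannian_metric_def by blast
  show ?thesis
    unfolding lin[OF coord_vec_tangent[OF c]]
    unfolding sym[OF coord_vec_tangent[OF c, of y] coord_vec_tangent[OF c]] lin[OF coord_vec_tangent[OF c]] ..
qed

lemma open_slit_domain: "c \<in> A \<Longrightarrow> open (slit_domain c)"
  unfolding slit_domain_def by (intro open_Times open_Compl chart_homeomorphism) simp_all

lemma Ck_on_coeffs:
  assumes "c \<in> A"
  shows "Ck_on k (chart_image c) (\<lambda>x. \<beta>_coord c x j)" "Ck_on k (chart_image c) (\<lambda>x. g_coord c x i j)"
    "Ck_on k (chart_image c) (f \<circ> chart_inv c)" "Ck_on k (chart_image c) (factor c)"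
    "Ck_on k (chart_image c) (\<lambda>x. \<beta>_conf c x j)" "Ck_on k (chart_image c) (\<lambda>x. g_conf c x i j)"
proof -
  note U = chart_homeomorphism(2)[OF assms]
  show \<beta>: "Ck_on k (chart_image c) (\<lambda>x. \<beta>_coord c x j)"
    using one_form assms unfolding one_form_def smooth_on_def \<beta>_coord_def by blast
  show g: "Ck_on k (chart_image c) (\<lambda>x. g_coord c x i j)"
    using riemannian assms unfolding riemannian_metric_def smooth_on_def g_coord_def by blast
  show f: "Ck_on k (chart_image c) (f \<circ> chart_inv c)"
    using f assms unfolding smooth_function_def smooth_on_def by blast
  show e: "Ck_on k (chart_image c) (factor c)"
    unfolding factor_def[abs_def] by (rule Ck_on_compose[OF U Ck_on_exp f]) simp
  show "Ck_on k (chart_image c) (\<lambda>x. \<beta>_conf c x j)"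
    unfolding \<beta>_conf_def by (rule Ck_on_mult[OF U e \<beta>])
  show "Ck_on k (chart_image c) (\<lambda>x. g_conf c x i j)"
    unfolding g_conf_def power2_eq_square by (rule Ck_on_mult[OF U Ck_on_mult[OF U e e] g])
qed

lemma differentiable_coeffs:
  assumes "c \<in> A" "x \<in> chart_image c"
  shows "(\<lambda>x. \<beta>_coord c x j) differentiable (at x)" "(f \<circ> chart_inv c) differentiable (at x)"
    "factor c differentiable (at x)" "(\<lambda>x. \<beta>_conf c x j) differentiable (at x)"
  using Ck_on_coeffs[OF assms(1), where k = "Suc 0"] assms(2) by simp_all

lemma in_chart_F_conf: "in_chart A c F_conf = (\<lambda>z. factor c (fst z) * in_chart A c F z)"
  by (simp add: in_chart_def F_conf_def factor_def fun_eq_iff)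

lemma sum_g_conf: "(\<Sum>l\<in>UNIV. (\<Sum>m\<in>UNIV. g_conf c x l m * y $ m) * y $ l) = (factor c x)\<^sup>2 * (\<Sum>l\<in>UNIV. (\<Sum>m\<in>UNIV. g_coord c x l m * y $ m) * y $ l)"
  by (simp add: g_conf_def sum_distrib_left sum_distrib_right mult_ac)

text \<open>On the slit domain \<open>e\<^sup>f F\<close> has Randers form for \<open>e\<^sup>2\<^sup>f g\<close> and \<open>e\<^sup>f \<beta>\<close>. Outside the chart image \<open>chart_inv\<close> is
arbitrary, and so is the coordinate expression.\<close>

lemma in_chart_F_conf_eq:
  assumes c: "c \<in> A" and z: "z \<in> slit_domain c"
  shows "in_chart A c F_conf z = randers_fun (g_conf c) (\<beta>_conf c) z"
proof -
  obtain x y where xy: "z = (x, y)" "x \<in> chart_image c" using z by (auto simp: slit_domain_def)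
  note q = chart_inv_charts_at[OF c xy(2)]
  have "in_chart A c F z = sqrt (\<Sum>l\<in>UNIV. (\<Sum>m\<in>UNIV. g_coord c x l m * y $ m) * y $ l) + (\<Sum>j\<in>UNIV. \<beta>_coord c x j * y $ j)"
    unfolding xy(1) in_chart_def prod.case F_eq[OF coord_vec_tangent[OF q]] g_coords[OF q] flat_coords[OF q, of y]
    by (simp add: g_coord_def \<beta>_coord_def)
  moreover have "sqrt (\<Sum>l\<in>UNIV. (\<Sum>m\<in>UNIV. g_conf c x l m * y $ m) * y $ l) =
      factor c x * sqrt (\<Sum>l\<in>UNIV. (\<Sum>m\<in>UNIV. g_coord c x l m * y $ m) * y $ l)"
    unfolding sum_g_conf by (simp add: real_sqrt_mult factor_def)
  moreover have "(\<Sum>j\<in>UNIV. \<beta>_conf c x j * y $ j) = factor c x * (\<Sum>j\<in>UNIV. \<beta>_coord c x j * y $ j)"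
    by (simp add: \<beta>_conf_def sum_distrib_left mult.assoc)
  ultimately show ?thesis
    unfolding in_chart_F_conf by (simp add: randers_fun_def xy(1) distrib_left)
qed

text \<open>The fundamental tensor of \<open>e\<^sup>f F\<close> is that of \<open>F\<close> multiplied by \<open>e\<^sup>2\<^sup>f\<close>, so strong convexity is preserved.\<close>

lemma finsler_F_conf: "finsler_metric A F_conf"
  unfolding finsler_metric_def
proof (intro conjI allI ballI impI)
  fix p v assume "v \<in> tangent_space A p" "v \<noteq> (\<lambda>_. 0)"
  then show "F_conf p v > 0" using finsler unfolding finsler_metric_def F_conf_def by auto
next
  fix p v and t :: real assume "v \<in> tangent_space A p" "0 \<le> t"
  then have "F p (\<lambda>c. t *\<^sub>R v c) = t * F p v" using finsler unfolding finsler_metric_def by blast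
  then show "F_conf p (\<lambda>c. t *\<^sub>R v c) = t * F_conf p v" by (simp add: F_conf_def)
next
  fix c assume c: "c \<in> A"
  note S = open_slit_domain[OF c]
  have "Ck_on k (slit_domain c) (in_chart A c F)" for k
    using finsler c unfolding finsler_metric_def smooth_on_def by blast
  moreover have "Ck_on k (slit_domain c) (\<lambda>z. factor c (fst z))" for k
    by (rule Ck_on_compose[OF S Ck_on_coeffs(4)[OF c] Ck_on_bounded_linear[OF bounded_linear_fst S]])
      (auto simp: slit_domain_def)
  ultimately show "smooth_on (slit_domain c) (in_chart A c F_conf)"
    unfolding smooth_on_def in_chart_F_conf using Ck_on_mult[OF S] by blast
next
  fix c z and u :: "real ^ 'n" assume c: "c \<in> A" and z: "z \<in> slit_domain c" and u: "u \<noteq> 0"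
  have "Ck_on 2 (slit_domain c) (in_chart A c F)"
    using finsler c unfolding finsler_metric_def smooth_on_def by blast
  moreover have "factor c differentiable (at (fst w))" if "w \<in> slit_domain c" for w
    using that by (intro differentiable_coeffs[OF c]) (auto simp: slit_domain_def)
  ultimately have "fundamental_tensor (in_chart A c F_conf) z = (factor c (fst z))\<^sup>2 *\<^sub>R fundamental_tensor (in_chart A c F) z"
    unfolding in_chart_F_conf by (rule fundamental_tensor_scale[OF open_slit_domain[OF c] z])
  moreover have "u \<bullet> (fundamental_tensor (in_chart A c F) z *v u) > 0"
    using finsler c z u unfolding finsler_metric_def by blast
  moreover have "factor c (fst z) \<noteq> 0" by (simp add: factor_def)
  ultimately show "u \<bullet> (fundamental_tensor (in_chart A c F_conf) z *v u) > 0"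
    by (simp add: scaleR_matrix_vector_assoc[symmetric])
qed

lemma randers_chart:
  assumes c: "c \<in> A"
  shows "randers_chart (chart_image c) (g_conf c) (\<beta>_conf c)"
proof
  show "open (chart_image c)" using c by (rule chart_homeomorphism)
  show "Ck_on 2 (chart_image c) (\<lambda>x. g_conf c x i j)" "Ck_on 2 (chart_image c) (\<lambda>x. \<beta>_conf c x i)" for i j
    by (rule Ck_on_coeffs[OF c])+
next
  fix x i j assume "x \<in> chart_image c"
  note q = chart_inv_charts_at[OF c this]
  have "g_coord c x i j = g_coord c x j i"
    unfolding g_coord_def using riemannian coord_vec_tangent[OF q] unfolding riemannian_metric_def by blast
  then show "g_conf c x i j = g_conf c x j i" by (simp add: g_conf_def)
next
  fix x and v :: "real ^ 'n" assume x: "x \<in> chart_image c" and v: "v \<noteq> 0"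
  note q = chart_inv_charts_at[OF c x]
  have "coord_vec A c (chart_inv c x) v \<noteq> (\<lambda>_. 0)"
    using v coord_vec_component[OF q, of v] by auto
  then have "g (chart_inv c x) (coord_vec A c (chart_inv c x) v) (coord_vec A c (chart_inv c x) v) > 0"
    using riemannian coord_vec_tangent[OF q] unfolding riemannian_metric_def by blast
  then show "(\<Sum>l\<in>UNIV. (\<Sum>m\<in>UNIV. g_conf c x l m * v $ m) * v $ l) > 0"
    unfolding g_coords[OF q] sum_g_conf by (simp add: g_coord_def factor_def)
next
  fix z assume "z \<in> chart_image c \<times> - {0 :: real ^ 'n}"
  then have z: "z \<in> slit_domain c" by (simp add: slit_domain_def)
  obtain x y where xy: "z = (x, y)" "x \<in> chart_image c" "y \<noteq> 0" using z by (auto simp: slit_domain_def)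
  note q = chart_inv_charts_at[OF c xy(2)]
  have "coord_vec A c (chart_inv c x) y \<noteq> (\<lambda>_. 0)"
    using xy(3) coord_vec_component[OF q, of y] by auto
  then have "in_chart A c F_conf z > 0"
    using finsler_F_conf coord_vec_tangent[OF q] unfolding xy(1) in_chart_def finsler_metric_def by auto
  then show "randers_fun (g_conf c) (\<beta>_conf c) z > 0" by (simp add: in_chart_F_conf_eq[OF c z])
  fix u :: "real ^ 'n" assume "u \<noteq> 0"
  then have "u \<bullet> (fundamental_tensor (in_chart A c F_conf) z *v u) > 0"
    using finsler_F_conf c z unfolding finsler_metric_def by blast
  then show "u \<bullet> (fundamental_tensor (randers_fun (g_conf c) (\<beta>_conf c)) z *v u) > 0"
    by (simp add: fundamental_tensor_cong[OF open_slit_domain[OF c] in_chart_F_conf_eq[OF c] z])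
qed

lemma douglas_type_iff_closed:
  "douglas_type A F_conf \<longleftrightarrow> (\<forall>c\<in>A. \<forall>x\<in>chart_image c. \<forall>k l.
     frechet_derivative (\<lambda>x. \<beta>_conf c x l) (at x) (axis k 1) = frechet_derivative (\<lambda>x. \<beta>_conf c x k) (at x) (axis l 1))"
proof -
  have "(\<forall>z\<in>slit_domain c. \<forall>i j k l. douglas_tensor (in_chart A c F_conf) i j k l z = 0) \<longleftrightarrow>
    (\<forall>x\<in>chart_image c. \<forall>k l.
     frechet_derivative (\<lambda>x. \<beta>_conf c x l) (at x) (axis k 1) = frechet_derivative (\<lambda>x. \<beta>_conf c x k) (at x) (axis l 1))"
    if c: "c \<in> A" for c
  proof -
    interpret randers_chart "chart_image c" "g_conf c" "\<beta>_conf c" using c by (rule randers_chart)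
    have "douglas_tensor (in_chart A c F_conf) i j k l z = douglas_tensor (randers_fun (g_conf c) (\<beta>_conf c)) i j k l z"
      if "z \<in> slit_domain c" for i j k l z
      by (rule douglas_tensor_cong[OF open_slit_domain[OF c] in_chart_F_conf_eq[OF c] that])
    then show ?thesis
      using douglas_iff_closed unfolding slit_domain_def curl_def db_def by simp
  qed
  then show ?thesis unfolding douglas_type_def using finsler_F_conf by blast
qed

lemma flat_vector_field_derivative:
  assumes Z: "vector_field A Z" and c: "c \<in> charts_at A p"
  shows "(((\<lambda>q. flat g X q (Z q)) \<circ> chart_inv c) has_derivative
    (\<lambda>u. \<Sum>j\<in>UNIV. \<beta>_coord c (snd c p) j * frechet_derivative (\<lambda>x. Z (chart_inv c x) c) (at (snd c p)) u $ j
       + frechet_derivative (\<lambda>x. \<beta>_coord c x j) (at (snd c p)) u * Z p c $ j)) (at (snd c p))"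
proof (rule has_derivative_transform_within_open)
  have A: "c \<in> A" "p \<in> fst c" using c by (auto simp: charts_at_def)
  show "open (chart_image c)" "snd c p \<in> chart_image c"
    by (rule chart_homeomorphism(2)[OF A(1)], rule snd_mem[OF A(2)])
  note x = this
  have Zp: "Z (chart_inv c (snd c p)) c = Z p c" using A by (simp add: chart_inv_snd)
  have "((\<lambda>x. Z (chart_inv c x) c $ j) has_derivative
      (\<lambda>u. frechet_derivative (\<lambda>x. Z (chart_inv c x) c) (at (snd c p)) u $ j)) (at (snd c p))" for j
    using vector_field_differentiable[OF Z c]
    by (intro bounded_linear.has_derivative[OF bounded_linear_vec_nth]) (simp add: frechet_derivative_works)
  moreover have "((\<lambda>x. \<beta>_coord c x j) has_derivative frechet_derivative (\<lambda>x. \<beta>_coord c x j) (at (snd c p))) (at (snd c p))" for j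
    using differentiable_coeffs(1)[OF A(1) x(2)] by (simp add: frechet_derivative_works)
  ultimately show "((\<lambda>x. \<Sum>j\<in>UNIV. \<beta>_coord c x j * Z (chart_inv c x) c $ j) has_derivative
    (\<lambda>u. \<Sum>j\<in>UNIV. \<beta>_coord c (snd c p) j * frechet_derivative (\<lambda>x. Z (chart_inv c x) c) (at (snd c p)) u $ j
       + frechet_derivative (\<lambda>x. \<beta>_coord c x j) (at (snd c p)) u * Z p c $ j)) (at (snd c p))"
    unfolding Zp[symmetric] by (intro has_derivative_sum has_derivative_mult)
  fix x assume "x \<in> chart_image c"
  note q = chart_inv_charts_at[OF A(1) this]
  have "Z (chart_inv c x) \<in> tangent_space A (chart_inv c x)" using Z by (simp add: vector_field_def)
  from flat_coords[OF q, of "Z (chart_inv c x) c"] tangent_eq_coord_vec[OF q this]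
  show "(\<Sum>j\<in>UNIV. \<beta>_coord c x j * Z (chart_inv c x) c $ j) = ((\<lambda>q. flat g X q (Z q)) \<circ> chart_inv c) x"
    by (simp add: \<beta>_coord_def)
qed

lemma flat_tangent:
  assumes c: "c \<in> charts_at A p" and v: "v \<in> tangent_space A p"
  shows "flat g X p v = (\<Sum>j\<in>UNIV. \<beta>_coord c (snd c p) j * v c $ j)"
  using flat_coords[OF c, of "v c"] c unfolding tangent_eq_coord_vec[OF c v]
  by (simp add: \<beta>_coord_def charts_at_def chart_inv_snd)

text \<open>The invariant expression, multiplied by \<open>e\<^sup>f\<close>, is the exterior derivative of \<open>e\<^sup>f \<beta>\<close> in coordinates: the derivatives of
the components of \<open>Y\<close> and \<open>Z\<close> cancel against the Lie bracket, and the derivatives of the factor \<open>e\<^sup>f\<close> give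
the terms with \<open>Yf\<close> and \<open>Zf\<close>.\<close>

lemma conformal_curl:
  assumes Y: "vector_field A Y" and Z: "vector_field A Z" and c: "c \<in> charts_at A p"
  shows "exp (f p) * (ext_deriv A (flat g X) Y Z p + vf_apply A Y f p * g p (X p) (Z p)
      - vf_apply A Z f p * g p (X p) (Y p)) =
    (\<Sum>j\<in>UNIV. frechet_derivative (\<lambda>x. \<beta>_conf c x j) (at (snd c p)) (Y p c) * Z p c $ j
       - frechet_derivative (\<lambda>x. \<beta>_conf c x j) (at (snd c p)) (Z p c) * Y p c $ j)"
proof -
  let ?x = "snd c p"
  let ?B = "\<lambda>j. frechet_derivative (\<lambda>x. \<beta>_coord c x j) (at ?x)" and ?f = "frechet_derivative (f \<circ> chart_inv c) (at ?x)"
  let ?DZ = "frechet_derivative (\<lambda>x. Z (chart_inv c x) c) (at ?x)" and ?DY = "frechet_derivative (\<lambda>x. Y (chart_inv c x) c) (at ?x)"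
  let ?b = "\<lambda>j. \<beta>_coord c ?x j"
  have A: "c \<in> A" "p \<in> fst c" using c by (auto simp: charts_at_def)
  note x = snd_mem[OF A(2)]
  have d: "((\<lambda>q. flat g X q (W q)) \<circ> chart_inv c) differentiable (at (snd c p))"
    if "vector_field A W" "c \<in> charts_at A p" for W c
    using flat_vector_field_derivative[OF that] by (rule differentiableI)
  have vf: "vf_apply A V (\<lambda>q. flat g X q (W q)) p =
      (\<Sum>j\<in>UNIV. ?b j * frechet_derivative (\<lambda>x. W (chart_inv c x) c) (at ?x) (V p c) $ j + ?B j (V p c) * W p c $ j)"
    if V: "vector_field A V" and W: "vector_field A W" for V W
    by (rule trans[OF vf_apply_chart[OF V c d[OF W]]
          fun_cong[OF frechet_derivative_at[OF flat_vector_field_derivative[OF W c], symmetric]]])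
  have fd: "(f \<circ> chart_inv c) differentiable (at (snd c p))" if "c \<in> charts_at A p" for c
    using that by (intro differentiable_coeffs) (auto simp: charts_at_def snd_mem)
  have Df: "vf_apply A V f p = ?f (V p c)" if "vector_field A V" for V
    by (rule vf_apply_chart[OF that c fd])
  have lie: "flat g X p (lie_bracket A Y Z p) = (\<Sum>j\<in>UNIV. ?b j * (?DZ (Y p c) $ j - ?DY (Z p c) $ j))"
    unfolding flat_tangent[OF c lie_bracket_tangent[OF Y Z]] using c by (simp add: lie_bracket_def)
  have T: "Y p \<in> tangent_space A p" "Z p \<in> tangent_space A p" using Y Z by (auto simp: vector_field_def)
  have De: "frechet_derivative (\<lambda>x. \<beta>_conf c x j) (at ?x) u = exp (f p) * (?f u * ?b j + ?B j u)" for j u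
  proof -
    have e: "(factor c has_derivative (\<lambda>u. exp (f p) * ?f u)) (at ?x)"
    proof -
      have "((f \<circ> chart_inv c) has_derivative ?f) (at ?x)" using fd[OF c] by (simp add: frechet_derivative_works)
      from has_derivative_exp[OF this] show ?thesis
        unfolding factor_def[abs_def] by (rule has_derivative_eq_rhs) (simp add: A chart_inv_snd fun_eq_iff)
    qed
    have "((\<lambda>x. \<beta>_coord c x j) has_derivative ?B j) (at ?x)"
      using differentiable_coeffs(1)[OF A(1) x] by (simp add: frechet_derivative_works)
    from frechet_derivative_at[OF has_derivative_mult[OF e this], symmetric]
    show ?thesis unfolding \<beta>_conf_def by (simp add: factor_def A chart_inv_snd algebra_simps)
  qed
  have fl: "g p (X p) v = flat g X p v" for v by (simp add: flat_def)
  have "ext_deriv A (flat g X) Y Z p = (\<Sum>j\<in>UNIV. ?B j (Y p c) * Z p c $ j - ?B j (Z p c) * Y p c $ j)"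
    unfolding ext_deriv_def vf[OF Y Z] vf[OF Z Y] lie sum_subtractf[symmetric]
    by (intro sum.cong refl) (simp add: algebra_simps)
  moreover have "vf_apply A Y f p * g p (X p) (Z p) = (\<Sum>j\<in>UNIV. ?f (Y p c) * (?b j * Z p c $ j))"
    "vf_apply A Z f p * g p (X p) (Y p) = (\<Sum>j\<in>UNIV. ?f (Z p c) * (?b j * Y p c $ j))"
    unfolding fl flat_tangent[OF c T(1)] flat_tangent[OF c T(2)] sum_distrib_left
      Df[OF Y] Df[OF Z] by simp_all
  ultimately show ?thesis
    unfolding De by (simp add: sum.distrib[symmetric] sum_subtractf[symmetric] sum_distrib_left algebra_simps)
qed

lemma douglas_type_conformal_iff:
  "douglas_type A F_conf \<longleftrightarrow>
    (\<forall>Y Z. vector_field A Y \<longrightarrow> vector_field A Z \<longrightarrow>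
      (\<forall>p. ext_deriv A (flat g X) Y Z p
            + vf_apply A Y f p * g p (X p) (Z p)
            - vf_apply A Z f p * g p (X p) (Y p) = 0))" (is "_ \<longleftrightarrow> ?R")
  unfolding douglas_type_iff_closed
proof (intro iffI allI impI ballI)
  fix Y Z p
  assume closed: "\<forall>c\<in>A. \<forall>x\<in>chart_image c. \<forall>k l. frechet_derivative (\<lambda>x. \<beta>_conf c x l) (at x) (axis k 1) =
      frechet_derivative (\<lambda>x. \<beta>_conf c x k) (at x) (axis l 1)"
    and Y: "vector_field A Y" and Z: "vector_field A Z"
  obtain c where c: "c \<in> charts_at A p" using chart_cover by blast
  then have A: "c \<in> A" "snd c p \<in> chart_image c" by (auto simp: charts_at_def snd_mem)
  let ?D = "\<lambda>j. frechet_derivative (\<lambda>x. \<beta>_conf c x j) (at (snd c p))"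
  have lin: "?D j u = (\<Sum>k\<in>UNIV. ?D j (axis k 1) * u $ k)" for j u
    using differentiable_coeffs(4)[OF A] by (intro linear_axis_expansion linear_frechet_derivative)
  have "(\<Sum>j\<in>UNIV. ?D j (Y p c) * Z p c $ j) = (\<Sum>j\<in>UNIV. \<Sum>k\<in>UNIV. ?D j (axis k 1) * Y p c $ k * Z p c $ j)"
    by (subst lin) (simp add: sum_distrib_right)
  also have "\<dots> = (\<Sum>k\<in>UNIV. \<Sum>j\<in>UNIV. ?D k (axis j 1) * Z p c $ j * Y p c $ k)"
    using closed A by (subst sum.swap) (auto simp: mult_ac intro!: sum.cong)
  also have "\<dots> = (\<Sum>j\<in>UNIV. ?D j (Z p c) * Y p c $ j)"
    by (subst (2) lin) (simp add: sum_distrib_right)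
  finally have "exp (f p) * (ext_deriv A (flat g X) Y Z p + vf_apply A Y f p * g p (X p) (Z p)
      - vf_apply A Z f p * g p (X p) (Y p)) = 0"
    unfolding conformal_curl[OF Y Z c] by (simp add: sum_subtractf)
  then show "ext_deriv A (flat g X) Y Z p + vf_apply A Y f p * g p (X p) (Z p)
      - vf_apply A Z f p * g p (X p) (Y p) = 0" by simp
next
  fix c x k l assume R: ?R and A: "c \<in> A" "x \<in> chart_image c"
  define p where "p = chart_inv c x"
  have c: "c \<in> charts_at A p" and x: "snd c p = x"
    using A by (simp_all add: p_def chart_inv_charts_at snd_chart_inv)
  \<comment> \<open>The components of the exterior derivative are its values on fields that are coordinate vectors at \<open>p\<close>.\<close>
  obtain Y Z where YZ: "vector_field A Y" "Y p c = axis k 1" "vector_field A Z" "Z p c = axis l 1"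
    using vector_field_exists[OF c] by metis
  have "ext_deriv A (flat g X) Y Z p + vf_apply A Y f p * g p (X p) (Z p)
      - vf_apply A Z f p * g p (X p) (Y p) = 0" using R YZ by blast
  then show "frechet_derivative (\<lambda>x. \<beta>_conf c x l) (at x) (axis k 1) = frechet_derivative (\<lambda>x. \<beta>_conf c x k) (at x) (axis l 1)"
    using conformal_curl[OF YZ(1,3) c] by (simp add: YZ x sum_subtractf sum_axis)
qed

end

theorem proposition2p5:
  fixes A :: "('m::{t2_space, second_countable_topology}, 'n::finite) atlas"
    and g :: "'m \<Rightarrow> ('m, 'n) tvec \<Rightarrow> ('m, 'n) tvec \<Rightarrow> real"
    and X :: "'m \<Rightarrow> ('m, 'n) tvec"
    and F :: "'m \<Rightarrow> ('m, 'n) tvec \<Rightarrow> real"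
    and f :: "'m \<Rightarrow> real"
  assumes "smooth_manifold A"
    and "riemannian_metric A g"
    and "vector_field A X"
    and "randers_metric A g (flat g X) F"
    and "smooth_function A f"
  shows "douglas_type A (\<lambda>p v. exp (f p) * F p v) \<longleftrightarrow>
    (\<forall>Y Z. vector_field A Y \<longrightarrow> vector_field A Z \<longrightarrow>
      (\<forall>p. ext_deriv A (flat g X) Y Z p
            + vf_apply A Y f p * g p (X p) (Z p)
            - vf_apply A Z f p * g p (X p) (Y p) = 0))"
proof -
  interpret conformal_randers A g X F f
    using assms by unfold_locales
  show ?thesis using douglas_type_conformal_iff unfolding F_conf_def[abs_def] .
qed

end
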